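(* Let $X$ be a metric space, let $\mu$ be a measure over $X$, let $\alpha>0$ and fix $A\subset X$. Assume: (1) $\mu$ is a Borel regular measure. (2) $\mathcal F_{\mu,\zeta_\alpha}$ covers $A$ finely. (3) $A$ is $\mathcal H^\alpha$-measurable and $\sigma$-finite with respect to $\mathcal H^\alpha$. (4) $A$ has a countable covering whose elements are open and have finite $\mu$-measure. (5) $\mu\llcorner A\ll\mathcal H^\alpha\llcorner A$. Then $\mathfrak d^\alpha(\mu,\cdot):A\to[0,+\infty]$ is $\mathcal H^\alpha$-measurable, every $\mathcal H^\alpha$-measurable set $B\subset A$ is also $\mu$-measurable, and for every such $B$ we have $$\mu(B)=\int_B\mathfrak d^\alpha(\mu,x)\,d\mathcal H^\alpha(x).$$
   Context: A "measure over $X$" is an outer measure defined on all subsets of $X$; measurability is in the sense of Carathéodory, and integrals are with respect to the restriction of the outer measure to its measurable sets. A measure $\mu$ over $X$ is Borel regular if all Borel sets are $\mu$-measurable and every $E\subset X$ is contained in a Borel set $E'$ with $\mu(E')=\mu(E)$. A set is $\sigma$-finite with respect to a measure over $X$ if it is covered by countably many sets of finite measure. $(\mu\llcorner A)(E)=\mu(A\cap E)$, and $\mu\llcorner A\ll\psi\llcorner A$ means that $\mu(N)=0$ for every $N\subset A$ with $\psi(N)=0$. $\mathcal F$ is the family of all closed subsets of $X$, $c_\alpha>0$ is a fixed constant, and $\zeta_\alpha:\mathcal F\to[0,+\infty]$ is $\zeta_\alpha(S)=c_\alpha\operatorname{diam}(S)^\alpha$ (with $\operatorname{diam}(\emptyset)=0$).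 The $\alpha$-dimensional Hausdorff measure is $$\mathcal H^\alpha(R)=\sup_{\delta>0}\inf\Big\{\sum_{j=0}^\infty\zeta_\alpha(E_j): E_j\in\mathcal F,\ \operatorname{diam}(E_j)\le\delta,\ R\subset\bigcup_jE_j\Big\}\qquad(\inf\emptyset=+\infty).$$ $\mathcal F_{\mu,\zeta_\alpha}=\mathcal F\setminus\{S\in\mathcal F:\ \zeta_\alpha(S)=\mu(S)=0\ \text{or}\ \mu(S)=\zeta_\alpha(S)=+\infty\}$. A family $\mathcal G\subset\mathcal P(X)$ covers $A$ finely if for every $a\in A$ and $\epsilon>0$ there is $S\in\mathcal G$ with $a\in S$ and $\operatorname{diam}(S)<\epsilon$. The quotient function $Q_{\mu,\zeta_\alpha}:\mathcal F_{\mu,\zeta_\alpha}\to[0,+\infty]$ is $Q_{\mu,\zeta_\alpha}(S)=+\infty$ if $\zeta_\alpha(S)=0$, $Q_{\mu,\zeta_\alpha}(S)=\mu(S)/\zeta_\alpha(S)$ if $0<\zeta_\alpha(S)<+\infty$, and $Q_{\mu,\zeta_\alpha}(S)=0$ if $\zeta_\alpha(S)=+\infty$. For $x\in A$ the Federer density is $$\mathfrak d^\alpha(\mu,x)=\inf_{\epsilon>0}\sup\{Q_{\mu,\zeta_\alpha}(S): S\in\mathcal F_{\mu,\zeta_\alpha},\ x\in S,\ \operatorname{diam}(S)<\epsilon\}.$$ *)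

theory Defs
  imports "HOL-Analysis.Analysis"
begin

section \<open>Measures over a space\<close>

text \<open>
  The space \<open>X\<close> is a type of class \<open>metric_space\<close>; subsets of \<open>X\<close> are sets over this type.
  The library's \<open>countably_subadditive\<close> only speaks about disjoint sequences, which together with
  \<open>increasing\<close> and all subsets being admissible gives the usual countable subadditivity.
\<close>

definition measure_over :: "('a set \<Rightarrow> ennreal) \<Rightarrow> bool" where
  "measure_over \<phi> \<longleftrightarrow> outer_measure_space (Pow UNIV) \<phi>"

definition caratheodory_sets :: "('a set \<Rightarrow> ennreal) \<Rightarrow> 'a set set" where
  "caratheodory_sets \<phi> = lambda_system UNIV (Pow UNIV) \<phi>"

definition caratheodory_measure :: "('a set \<Rightarrow> ennreal) \<Rightarrow> 'a measure" where
  "caratheodory_measure \<phi> = measure_of UNIV (caratheodory_sets \<phi>) \<phi>"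

lemma caratheodory_sets_iff:
  "E \<in> caratheodory_sets \<phi> \<longleftrightarrow> (\<forall>T. \<phi> T = \<phi> (T \<inter> E) + \<phi> (T - E))"
  unfolding caratheodory_sets_def algebra.lambda_system_eq[OF sigma_algebra.axioms(1)[OF sigma_algebra_Pow]]
  by (simp add: eq_commute)

lemma
  assumes "measure_over \<phi>"
  shows sets_caratheodory_measure: "sets (caratheodory_measure \<phi>) = caratheodory_sets \<phi>"
    and emeasure_caratheodory_measure:
      "E \<in> caratheodory_sets \<phi> \<Longrightarrow> emeasure (caratheodory_measure \<phi>) E = \<phi> E"
proof -
  have ms: "measure_space UNIV (caratheodory_sets \<phi>) \<phi>"
    using sigma_algebra.caratheodory_lemma[OF sigma_algebra_Pow assms[unfolded measure_over_def]]
    by (simp add: caratheodory_sets_def)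
  then interpret sigma_algebra UNIV "caratheodory_sets \<phi>"
    by (simp add: measure_space_def)
  show eq: "sets (caratheodory_measure \<phi>) = caratheodory_sets \<phi>"
    by (simp add: caratheodory_measure_def sets_measure_of_eq)
  show "emeasure (caratheodory_measure \<phi>) E = \<phi> E" if "E \<in> caratheodory_sets \<phi>"
    using emeasure_measure_of_sigma[OF sigma_algebra_axioms _ _ that] ms
    by (simp add: measure_space_def caratheodory_measure_def)
qed

definition borel_regular :: "('a::topological_space set \<Rightarrow> ennreal) \<Rightarrow> bool" where
  "borel_regular \<phi> \<longleftrightarrow>
     (\<forall>B \<in> sets borel. B \<in> caratheodory_sets \<phi>) \<and>
     (\<forall>E. \<exists>E' \<in> sets borel. E \<subseteq> E' \<and> \<phi> E' = \<phi> E)"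

definition sigma_finite_over :: "('a set \<Rightarrow> ennreal) \<Rightarrow> 'a set \<Rightarrow> bool" where
  "sigma_finite_over \<phi> A \<longleftrightarrow> (\<exists>\<C>. countable \<C> \<and> A \<subseteq> \<Union>\<C> \<and> (\<forall>E\<in>\<C>. \<phi> E < \<infinity>))"

text \<open>\<open>abs_cont_restricted A \<mu> \<psi>\<close> expresses that \<open>\<mu>\<close> restricted to \<open>A\<close> is absolutely continuous
  with respect to \<open>\<psi>\<close> restricted to \<open>A\<close>.\<close>

definition abs_cont_restricted :: "'a set \<Rightarrow> ('a set \<Rightarrow> ennreal) \<Rightarrow> ('a set \<Rightarrow> ennreal) \<Rightarrow> bool" where
  "abs_cont_restricted A \<mu> \<psi> \<longleftrightarrow> (\<forall>N. N \<subseteq> A \<longrightarrow> \<psi> N = 0 \<longrightarrow> \<mu> N = 0)"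


section \<open>Hausdorff measure\<close>

text \<open>
  The library's \<open>diameter\<close> is real-valued and equals 0 on unbounded sets, so an
  extended-valued diameter is needed. The supremum over the empty set is 0.
\<close>

definition ediam :: "'a::metric_space set \<Rightarrow> ennreal" where
  "ediam S = (SUP (x, y) \<in> S \<times> S. ennreal (dist x y))"

text \<open>\<open>hzeta c \<alpha> S\<close> is \<open>c \<cdot> diam(S)\<^sup>\<alpha>\<close>, used for \<open>c > 0\<close> and \<open>\<alpha> > 0\<close>.\<close>

definition hzeta :: "real \<Rightarrow> real \<Rightarrow> 'a::metric_space set \<Rightarrow> ennreal" where
  "hzeta c \<alpha> S = (if ediam S = \<infinity> then \<infinity> else ennreal (c * enn2real (ediam S) powr \<alpha>))"

definition hausdorff_measure :: "real \<Rightarrow> real \<Rightarrow> 'a::metric_space set \<Rightarrow> ennreal" where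
  "hausdorff_measure c \<alpha> R =
     (SUP \<delta> \<in> {0::real<..}.
        INF E \<in> {E :: nat \<Rightarrow> 'a set.
                   (\<forall>j. closed (E j) \<and> ediam (E j) \<le> ennreal \<delta>) \<and> R \<subseteq> (\<Union>j. E j)}.
          \<Sum>j. hzeta c \<alpha> (E j))"


section \<open>Federer density\<close>

definition admissible_sets ::
  "('a::topological_space set \<Rightarrow> ennreal) \<Rightarrow> ('a set \<Rightarrow> ennreal) \<Rightarrow> 'a set set" where
  "admissible_sets \<mu> \<zeta> =
     {S. closed S} - {S. closed S \<and> ((\<zeta> S = 0 \<and> \<mu> S = 0) \<or> (\<mu> S = \<infinity> \<and> \<zeta> S = \<infinity>))}"

definition covers_finely :: "'a::metric_space set set \<Rightarrow> 'a set \<Rightarrow> bool" where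
  "covers_finely \<G> A \<longleftrightarrow> (\<forall>a\<in>A. \<forall>\<epsilon>>0::real. \<exists>S\<in>\<G>. a \<in> S \<and> ediam S < ennreal \<epsilon>)"

text \<open>Only meaningful on \<open>admissible_sets \<mu> \<zeta>\<close>.\<close>

definition quotient_fun :: "('a set \<Rightarrow> ennreal) \<Rightarrow> ('a set \<Rightarrow> ennreal) \<Rightarrow> 'a set \<Rightarrow> ennreal" where
  "quotient_fun \<mu> \<zeta> S =
     (if \<zeta> S = 0 then \<infinity> else if \<zeta> S < \<infinity> then \<mu> S / \<zeta> S else 0)"

definition federer_density ::
  "real \<Rightarrow> real \<Rightarrow> ('a::metric_space set \<Rightarrow> ennreal) \<Rightarrow> 'a \<Rightarrow> ennreal" where
  "federer_density c \<alpha> \<mu> x =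
     (INF \<epsilon> \<in> {0::real<..}.
        SUP S \<in> {S \<in> admissible_sets \<mu> (hzeta c \<alpha>). x \<in> S \<and> ediam S < ennreal \<epsilon>}.
          quotient_fun \<mu> (hzeta c \<alpha>) S)"

end

theory Submission
  imports Defs
begin

text \<open>
  Write \<open>H\<close> for the Hausdorff measure and \<open>d\<close> for the Federer density of \<open>\<mu>\<close>. If \<open>d < t\<close> on \<open>B\<close>, efficient
  covers of \<open>B\<close> show \<open>\<mu> B \<le> t * H B\<close>; if \<open>d > t\<close> on \<open>B\<close>, a Vitali-type disjoint selection shows
  \<open>t * H B \<le> \<mu> V\<close> for every open \<open>V \<supseteq> B\<close> of finite measure. Neither bound needs \<open>B\<close> to be measurable.

  By the Radon-Nikodym theorem \<open>\<mu>\<close> has some density \<open>f\<close> with respect to \<open>H\<close> on \<open>A\<close>. On a set where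
  \<open>f < s < t < d\<close> the lower bound makes \<open>\<mu>\<close> at least \<open>t * H\<close>, while integrating \<open>f\<close> over an \<open>H\<close>-hull
  makes it at most \<open>s * H\<close>; where \<open>d < s < t < f\<close> the same happens with a \<open>\<mu>\<close>-hull. Hence \<open>d = f\<close>
  up to an \<open>H\<close>-null set, and all such sets are Caratheodory measurable, so \<open>d\<close> is measurable and is
  itself a density.
\<close>

section \<open>Outer measures\<close>

lemma measure_over_empty [simp]: "measure_over \<phi> \<Longrightarrow> \<phi> {} = 0"
  by (simp add: measure_over_def outer_measure_space_def positive_def)

lemma measure_over_mono: "measure_over \<phi> \<Longrightarrow> S \<subseteq> T \<Longrightarrow> \<phi> S \<le> \<phi> T"
  by (auto simp: measure_over_def outer_measure_space_def increasing_def)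

lemma measure_over_null_mono: "measure_over \<phi> \<Longrightarrow> S \<subseteq> N \<Longrightarrow> \<phi> N = 0 \<Longrightarrow> \<phi> S = 0"
  using measure_over_mono[of \<phi> S N] by simp

text \<open>Countable subadditivity in \<open>outer_measure_space\<close> speaks of disjoint
  sequences only, so \<open>disjointed\<close> makes the sequence disjoint without changing its
  union, and monotonicity bounds the new terms by the old ones.\<close>

lemma measure_over_UN:
  fixes E :: "nat \<Rightarrow> 'a set"
  assumes "measure_over \<phi>"
  shows "\<phi> (\<Union>n. E n) \<le> (\<Sum>n. \<phi> (E n))"
proof -
  have "\<phi> (\<Union>n. E n) = \<phi> (\<Union>n. disjointed E n)"
    by (simp add: UN_disjointed_eq)
  also have "\<dots> \<le> (\<Sum>n. \<phi> (disjointed E n))"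
    using assms disjoint_family_disjointed[of E]
    by (auto simp: measure_over_def outer_measure_space_def countably_subadditive_def)
  also have "\<dots> \<le> (\<Sum>n. \<phi> (E n))"
    by (intro suminf_le measure_over_mono[OF assms] disjointed_subset summableI)
  finally show ?thesis .
qed

lemma measure_over_Un:
  assumes "measure_over \<phi>"
  shows "\<phi> (S \<union> T) \<le> \<phi> S + \<phi> T"
proof -
  have "\<phi> (S \<union> T) = \<phi> (\<Union>n::nat. if n = 0 then S else if n = 1 then T else {})"
    by (rule arg_cong[of _ _ \<phi>]) (auto split: if_splits)
  also have "\<dots> \<le> (\<Sum>n. \<phi> (if n = 0 then S else if n = 1 then T else {}))"
    by (rule measure_over_UN[OF assms])
  also have "\<dots> = (\<Sum>n\<in>{0,1::nat}. \<phi> (if n = 0 then S else if n = 1 then T else {}))"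
    using assms by (intro suminf_finite) auto
  finally show ?thesis by simp
qed

lemma measure_over_null_UN:
  fixes E :: "'i \<Rightarrow> 'a set"
  assumes \<phi>: "measure_over \<phi>" and I: "countable I" and null: "\<And>i. i \<in> I \<Longrightarrow> \<phi> (E i) = 0"
  shows "\<phi> (\<Union>i\<in>I. E i) = 0"
proof (cases "I = {}")
  case False
  have "\<phi> (\<Union>i\<in>I. E i) = \<phi> (\<Union>n. E (from_nat_into I n))"
    by (metis False I image_image range_from_nat_into)
  also have "\<dots> \<le> (\<Sum>n. \<phi> (E (from_nat_into I n)))"
    by (rule measure_over_UN[OF \<phi>])
  finally show ?thesis
    using null False by (simp add: from_nat_into)
qed (use \<phi> in simp)

section \<open>Caratheodory measurability and measurable hulls\<close>

lemma caratheodory_setsI: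
  assumes \<phi>: "measure_over \<phi>" and "\<And>T. \<phi> T < \<infinity> \<Longrightarrow> \<phi> (T \<inter> E) + \<phi> (T - E) \<le> \<phi> T"
  shows "E \<in> caratheodory_sets \<phi>"
  unfolding caratheodory_sets_iff
proof (intro allI antisym)
  fix T
  show "\<phi> T \<le> \<phi> (T \<inter> E) + \<phi> (T - E)"
    using measure_over_Un[OF \<phi>, of "T \<inter> E" "T - E"] by (simp add: Un_Diff_Int sup_commute)
  show "\<phi> (T \<inter> E) + \<phi> (T - E) \<le> \<phi> T"
    using assms(2)[of T] by (cases "\<phi> T = \<infinity>") (auto simp: less_top)
qed

lemma null_caratheodory_sets:
  assumes "measure_over \<phi>" "\<phi> N = 0"
  shows "N \<in> caratheodory_sets \<phi>"
proof (rule caratheodory_setsI[OF assms(1)])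
  fix T
  have "\<phi> (T \<inter> N) = 0"
    using measure_over_mono[OF assms(1), of "T \<inter> N" N] assms(2) by auto
  then show "\<phi> (T \<inter> N) + \<phi> (T - N) \<le> \<phi> T"
    using measure_over_mono[OF assms(1), of "T - N" T] by auto
qed

lemma space_caratheodory_measure [simp]: "space (caratheodory_measure \<phi>) = UNIV"
  by (simp add: caratheodory_measure_def space_measure_of_conv)

text \<open>The infimum over measurable supersets is attained at the hull \<open>S'\<close>. This
  makes facts about \<open>outer_measure_of\<close>, above all continuity along increasing sequences
  of arbitrary sets, available for \<phi>.\<close>

lemma caratheodory_measure_outer:
  assumes \<phi>: "measure_over \<phi>" and hull: "\<exists>S'\<in>caratheodory_sets \<phi>. S \<subseteq> S' \<and> \<phi> S' = \<phi> S"
  shows "outer_measure_of (caratheodory_measure \<phi>) S = \<phi> S"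
  unfolding outer_measure_of_def
proof (rule antisym)
  show "(INF B\<in>{B \<in> sets (caratheodory_measure \<phi>). S \<subseteq> B}. emeasure (caratheodory_measure \<phi>) B) \<le> \<phi> S"
    using hull by (auto intro!: INF_lower2 simp: sets_caratheodory_measure[OF \<phi>] emeasure_caratheodory_measure[OF \<phi>])
  show "\<phi> S \<le> (INF B\<in>{B \<in> sets (caratheodory_measure \<phi>). S \<subseteq> B}. emeasure (caratheodory_measure \<phi>) B)"
    by (auto intro!: INF_greatest measure_over_mono[OF \<phi>] simp: sets_caratheodory_measure[OF \<phi>] emeasure_caratheodory_measure[OF \<phi>])
qed

lemma borel_regular_outer:
  assumes "measure_over \<phi>" "borel_regular \<phi>"
  shows "outer_measure_of (caratheodory_measure \<phi>) S = \<phi> S"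
  by (rule caratheodory_measure_outer) (use assms in \<open>unfold borel_regular_def, blast+\<close>)

lemma borel_caratheodory_sets: "borel_regular \<phi> \<Longrightarrow> B \<in> sets borel \<Longrightarrow> B \<in> caratheodory_sets \<phi>"
  by (auto simp: borel_regular_def)

section \<open>Caratheodory's criterion for metric outer measures\<close>

lemma ennreal_suminf_small_tail:
  fixes a :: "nat \<Rightarrow> ennreal"
  assumes fin: "(\<Sum>n. a n) < \<infinity>" and e: "e > 0"
  shows "\<exists>n. (\<Sum>k. a (k + n)) < e"
proof (cases "(\<Sum>n. a n) = 0")
  case True
  then show ?thesis using e by (intro exI[of _ 0]) simp
next
  case False
  \<comment> \<open>Subtraction is truncated at 0 and infinity minus a finite number is infinity, so
    strictness rests on the total being finite and nonzero.\<close>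
  have "(\<Sum>n. a n) - e < (\<Sum>n. a n)"
    using fin e False by (intro ennreal_between) (auto simp: zero_less_iff_neq_zero)
  then obtain n where n: "(\<Sum>n. a n) - e < (\<Sum>i<n. a i)"
    by (auto simp: suminf_eq_SUP less_SUP_iff)
  have "\<not> e \<le> (\<Sum>k. a (k + n))"
  proof
    assume *: "e \<le> (\<Sum>k. a (k + n))"
    have eq: "(\<Sum>n. a n) = (\<Sum>k. a (k + n)) + (\<Sum>i<n. a i)"
      by (rule suminf_offset) auto
    have "(\<Sum>i<n. a i) + e \<le> (\<Sum>n. a n)"
      using * by (simp add: eq add.commute)
    then have "(\<Sum>i<n. a i) \<le> (\<Sum>n. a n) - e"
      by (simp add: ennreal_le_minus_iff)
    with n show False by simp
  qed
  then show ?thesis by (auto simp: not_le)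
qed

text \<open>Caratheodory's criterion: the layers \<open>R k\<close> of \<open>T - F\<close> are separated from each other
  when their indices have the same parity, hence their measures are summable.\<close>

lemma metric_outer_measure_closed:
  fixes \<phi> :: "'a::metric_space set \<Rightarrow> ennreal"
  assumes \<phi>: "measure_over \<phi>"
    and metric: "\<And>S T r. 0 < r \<Longrightarrow> (\<And>x y. x \<in> S \<Longrightarrow> y \<in> T \<Longrightarrow> r \<le> dist x y) \<Longrightarrow> \<phi> S + \<phi> T \<le> \<phi> (S \<union> T)"
    and F: "closed F"
  shows "F \<in> caratheodory_sets \<phi>"
\<comment> \<open>By convention \<open>infdist\<close> to the empty set is 0, so it does not measure
  separation there.\<close>
proof (cases "F = {}")
  case True
  then show ?thesis using \<phi> by (simp add: null_caratheodory_sets)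
next
  case False
  show ?thesis
  proof (rule caratheodory_setsI[OF \<phi>])
    fix T assume fin: "\<phi> T < \<infinity>"
    define u where "u n = inverse (real (Suc n))" for n
    have u: "u n > 0" "m \<le> n \<Longrightarrow> u n \<le> u m" "m < n \<Longrightarrow> u n < u m" for m n
      by (auto simp: u_def)
    define D where "D n = {x\<in>T. u n \<le> infdist x F}" for n
    \<comment> \<open>The layer \<open>R n\<close> holds the points of \<open>T\<close> with
      \<open>u (Suc n) \<le> infdist x F < u n\<close>.\<close>
    define R where "R n = D (Suc n) - D n" for n
    have parity: "(\<Sum>k<n. \<phi> (R (2 * k + p))) \<le> \<phi> (\<Union>k<n. R (2 * k + p))" for n p
    proof (induction n)
      case (Suc n)
      let ?S = "\<Union>k<n. R (2 * k + p)" and ?T = "R (2 * n + p)"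
      have "\<phi> ?S + \<phi> ?T \<le> \<phi> (?S \<union> ?T)"
      proof (cases n)
        case (Suc m)
        show ?thesis
        proof (rule metric)
          \<comment> \<open>The earlier layers stay at distance at least
            \<open>u (2 * m + p + 1)\<close> from \<open>F\<close>, while the new one is closer than
            \<open>u (2 * n + p)\<close>. The skipped layer between them is the gap.\<close>
          show "0 < u (2 * m + p + 1) - u (2 * n + p)"
            using Suc u(3)[of "2*m+p+1" "2*n+p"] by simp
          fix x y assume "x \<in> ?S" "y \<in> ?T"
          then obtain k where k: "k < n" "x \<in> R (2 * k + p)" by auto
          have "u (2 * m + p + 1) \<le> u (Suc (2 * k + p))"
            using k(1) Suc by (intro u) auto
          also have "\<dots> \<le> infdist x F" using k(2) by (auto simp: R_def D_def)
          finally have "u (2 * m + p + 1) \<le> infdist x F" .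
          moreover have "infdist y F < u (2 * n + p)"
            using \<open>y \<in> ?T\<close> by (auto simp: R_def D_def)
          moreover have "infdist x F \<le> infdist y F + dist x y" by (rule infdist_triangle)
          ultimately show "u (2 * m + p + 1) - u (2 * n + p) \<le> dist x y" by linarith
        qed
      qed (use \<phi> in simp)
      also have "?S \<union> ?T = (\<Union>k<Suc n. R (2 * k + p))" by (auto simp: less_Suc_eq)
      finally show ?case using Suc.IH by (auto intro: order_trans add_right_mono)
    qed (use \<phi> in simp)
    have "(\<Sum>k<n. \<phi> (R k)) \<le> 2 * \<phi> T" for n
    proof -
      \<comment> \<open>Doubling the range lets it split into \<open>n\<close> even and
        \<open>n\<close> odd indices, each half being bounded by \<open>\<phi> T\<close> through
        \<open>parity\<close>.\<close>
      have "(\<Sum>k<n. \<phi> (R k)) \<le> (\<Sum>k<2*n. \<phi> (R k))" by (intro sum_mono2) auto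
      also have "\<dots> = (\<Sum>k<n. \<phi> (R (2 * k + 0))) + (\<Sum>k<n. \<phi> (R (2 * k + 1)))"
        by (induction n) (auto simp: algebra_simps)
      also have "\<dots> \<le> \<phi> T + \<phi> T"
        by (intro add_mono order_trans[OF parity] measure_over_mono[OF \<phi>]) (auto simp: R_def D_def)
      finally show ?thesis by (simp add: mult_2)
    qed
    then have "(\<Sum>k. \<phi> (R k)) \<le> 2 * \<phi> T" by (intro suminf_le_const) auto
    also have "2 * \<phi> T < \<infinity>" using fin by (simp add: ennreal_mult_less_top)
    finally have sum_fin: "(\<Sum>k. \<phi> (R k)) < \<infinity>" .
    show "\<phi> (T \<inter> F) + \<phi> (T - F) \<le> \<phi> T"
    proof (rule ennreal_le_epsilon)
      fix e :: real assume "0 < e"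
      with ennreal_suminf_small_tail[OF sum_fin, of "ennreal e"]
      obtain n where n: "(\<Sum>k. \<phi> (R (k + n))) < ennreal e" by (auto simp: ennreal_less_zero_iff)
      have "T - F \<subseteq> D n \<union> (\<Union>k. R (k + n))"
      proof
        fix x assume x: "x \<in> T - F"
        then have "infdist x F > 0"
          using F False infdist_nonneg[of x F] in_closed_iff_infdist_zero[of F x] by fastforce
        then obtain m where "u m < infdist x F"
          unfolding u_def using reals_Archimedean by blast
        then have ex: "\<exists>m. x \<in> D m" using x by (auto simp: D_def intro: less_imp_le)
        \<comment> \<open>If the first \<open>D m\<close> containing \<open>x\<close> comes after
          \<open>D n\<close>, then \<open>x\<close> lies in the layer \<open>R (m - 1)\<close>,
          which belongs to the tail starting at \<open>n\<close>.\<close>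
        define m where "m = (LEAST m. x \<in> D m)"
        have m: "x \<in> D m" unfolding m_def by (rule LeastI_ex[OF ex])
        show "x \<in> D n \<union> (\<Union>k. R (k + n))"
        proof (cases "m \<le> n")
          case True
          then show ?thesis using m u(2)[of m n] by (auto simp: D_def)
        next
          case False
          then have "x \<notin> D (m - 1)" using not_less_Least[of "m - 1" "\<lambda>m. x \<in> D m"] by (auto simp: m_def)
          then have "x \<in> R (m - 1)" using m False by (auto simp: R_def)
          moreover have "m - 1 = (m - 1 - n) + n" using False by simp
          ultimately show ?thesis by (metis UnI2 UN_I UNIV_I)
        qed
      qed
      then have "\<phi> (T - F) \<le> \<phi> (D n \<union> (\<Union>k. R (k + n)))" by (rule measure_over_mono[OF \<phi>])
      also have "\<dots> \<le> \<phi> (D n) + \<phi> (\<Union>k. R (k + n))" by (rule measure_over_Un[OF \<phi>])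
      also have "\<dots> \<le> \<phi> (D n) + ennreal e"
        using measure_over_UN[OF \<phi>, of "\<lambda>k. R (k + n)"] n by (intro add_left_mono) auto
      finally have "\<phi> (T \<inter> F) + \<phi> (T - F) \<le> (\<phi> (T \<inter> F) + \<phi> (D n)) + ennreal e"
        by (simp add: add.assoc add_left_mono)
      also have "\<phi> (T \<inter> F) + \<phi> (D n) \<le> \<phi> ((T \<inter> F) \<union> D n)"
      proof (rule metric[OF u(1)])
        fix x y assume "x \<in> T \<inter> F" "y \<in> D n"
        then have "u n \<le> infdist y F" "infdist y F \<le> dist y x"
          by (auto simp: D_def infdist_le)
        then show "u n \<le> dist x y" by (simp add: dist_commute)
      qed
      also have "\<phi> ((T \<inter> F) \<union> D n) \<le> \<phi> T"
        by (rule measure_over_mono[OF \<phi>]) (auto simp: D_def)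
      finally show "\<phi> (T \<inter> F) + \<phi> (T - F) \<le> \<phi> T + ennreal e"
        by (auto intro: add_right_mono)
    qed
  qed
qed

lemma sigma_algebra_caratheodory_sets:
  assumes "measure_over \<phi>"
  shows "sigma_algebra UNIV (caratheodory_sets \<phi>)"
  using sets.sigma_algebra_axioms[of "caratheodory_measure \<phi>"] sets_caratheodory_measure[OF assms] by simp

lemma metric_outer_measure_borel:
  fixes \<phi> :: "'a::metric_space set \<Rightarrow> ennreal"
  assumes \<phi>: "measure_over \<phi>"
    and metric: "\<And>S T r. 0 < r \<Longrightarrow> (\<And>x y. x \<in> S \<Longrightarrow> y \<in> T \<Longrightarrow> r \<le> dist x y) \<Longrightarrow> \<phi> S + \<phi> T \<le> \<phi> (S \<union> T)"
    and B: "B \<in> sets borel"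
  shows "B \<in> caratheodory_sets \<phi>"
proof -
  have "sigma_sets UNIV (Collect closed) \<subseteq> caratheodory_sets \<phi>"
    by (intro sigma_algebra.sigma_sets_subset[OF sigma_algebra_caratheodory_sets[OF \<phi>]] subsetI)
       (simp, rule metric_outer_measure_closed[OF \<phi> metric])
  then show ?thesis using B by (auto simp: borel_eq_closed)
qed

section \<open>Approximation by open sets\<close>

text \<open>The sets with this property contain the closed sets and form a sigma-algebra. Asking for
  closed and open approximation at once makes complementation a mere exchange of \<open>F\<close>
  and \<open>G\<close>.\<close>

lemma finite_borel_measure_approx:
  fixes M :: "'a::metric_space measure"
  assumes "finite_measure M" and sets_M: "sets M = sets borel" and B: "B \<in> sets borel" and e: "0 < (e::real)"
  shows "\<exists>F G. closed F \<and> open G \<and> F \<subseteq> B \<and> B \<subseteq> G \<and> measure M (G - F) < e"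
proof -
  interpret finite_measure M by fact
  have closed_M: "closed F \<Longrightarrow> F \<in> sets M" and open_M: "open G \<Longrightarrow> G \<in> sets M" for F G
    by (auto simp: sets_M)
  have "B \<in> sigma_sets UNIV (Collect closed)"
    using B by (simp add: borel_eq_closed)
  then show ?thesis using e
  proof (induction arbitrary: e)
    case (Basic C)
    show ?case
    proof (cases "C = {}")
      case True
      then show ?thesis using Basic by (intro exI[of _ "{}"]) auto
    next
      case False
      have C: "closed C" using Basic by simp
      \<comment> \<open>Since \<open>C\<close> is closed and nonempty, these open neighbourhoods
        shrink to \<open>C\<close>, and finiteness of \<open>M\<close> sends the measure of
        \<open>G n - C\<close> to 0.\<close>
      define G where "G n = {x. infdist x C < inverse (real (Suc n))}" for n
      have G: "open (G n)" "C \<subseteq> G n" for n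
        unfolding G_def by (auto intro!: open_Collect_less continuous_intros)
      have "(\<lambda>n. measure M (G n - C)) \<longlonglongrightarrow> measure M (\<Inter>n. G n - C)"
      proof (rule finite_Lim_measure_decseq)
        show "range (\<lambda>n. G n - C) \<subseteq> sets M" using open_M[OF G(1)] closed_M[OF C] by auto
        have "inverse (real (Suc n)) \<le> inverse (real (Suc m))" if "m \<le> n" for m n
          using that by (intro le_imp_inverse_le) auto
        then show "decseq (\<lambda>n. G n - C)"
          unfolding decseq_def G_def using less_le_trans by blast
      qed
      also have "(\<Inter>n. G n - C) = {}"
      proof (rule ccontr)
        assume "(\<Inter>n. G n - C) \<noteq> {}"
        then obtain x where x: "\<And>n. x \<in> G n" "x \<notin> C" by blast
        then have "0 < infdist x C"
          using C False infdist_nonneg[of x C] in_closed_iff_infdist_zero[of C x] by fastforce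
        then obtain n where "inverse (real (Suc n)) < infdist x C" using reals_Archimedean by blast
        then show False using x(1)[of n] by (simp add: G_def)
      qed
      finally have "(\<lambda>n. measure M (G n - C)) \<longlonglongrightarrow> 0" by simp
      then have "eventually (\<lambda>n. measure M (G n - C) < e) sequentially"
        using Basic by (intro order_tendstoD) auto
      then obtain n where "measure M (G n - C) < e" by (auto simp: eventually_sequentially)
      then show ?thesis using C G[of n] by blast
    qed
  next
    case Empty
    then show ?case by (intro exI[of _ "{}"]) auto
  next
    case (Compl B)
    from Compl.IH[OF Compl.prems] obtain F G
      where FG: "closed F" "open G" "F \<subseteq> B" "B \<subseteq> G" "measure M (G - F) < e" by blast
    have "- F - - G = G - F" by auto
    then have "closed (- G) \<and> open (- F) \<and> - G \<subseteq> UNIV - B \<and> UNIV - B \<subseteq> - F \<and> measure M (- F - - G) < e"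
      using FG by auto
    then show ?case by blast
  next
    case (Union A)
    \<comment> \<open>These errors total \<open>e / 2\<close>. The other half pays for truncating
      the union of the closed sets.\<close>
    define \<epsilon> where "\<epsilon> i = e / 2 * (1/2) ^ Suc i" for i :: nat
    have \<epsilon>: "0 < \<epsilon> i" for i using Union.prems by (simp add: \<epsilon>_def)
    have \<epsilon>_sums: "\<epsilon> sums (e / 2)"
      unfolding \<epsilon>_def using sums_mult[OF power_half_series, of "e / 2"] by simp
    have "\<exists>F G. closed F \<and> open G \<and> F \<subseteq> A i \<and> A i \<subseteq> G \<and> measure M (G - F) < \<epsilon> i" for i
      using Union.IH \<epsilon> by blast
    then obtain F G where FG: "\<And>i. closed (F i)" "\<And>i. open (G i)" "\<And>i. F i \<subseteq> A i" "\<And>i. A i \<subseteq> G i"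
      "\<And>i. measure M (G i - F i) < \<epsilon> i" by metis
    let ?G = "\<Union>i. G i"
    have sets: "G i \<in> sets M" "F i \<in> sets M" for i using FG open_M closed_M by auto
    have sm: "summable (\<lambda>i. measure M (G i - F i))"
      using FG(5) by (intro summable_comparison_test'[OF sums_summable[OF \<epsilon>_sums]]) (auto simp: less_imp_le)
    have "measure M (?G - (\<Union>i. F i)) \<le> measure M (\<Union>i. G i - F i)"
      using sets by (intro finite_measure_mono) auto
    also have "\<dots> \<le> (\<Sum>i. measure M (G i - F i))"
      using sets sm by (intro finite_measure_subadditive_countably) auto
    also have "\<dots> \<le> (\<Sum>i. \<epsilon> i)"
      using FG(5) sm sums_summable[OF \<epsilon>_sums] by (intro suminf_le) (auto simp: less_imp_le)
    also have "\<dots> = e / 2" using \<epsilon>_sums by (simp add: sums_iff)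
    finally have le: "measure M (?G - (\<Union>i. F i)) \<le> e / 2" .
    \<comment> \<open>An infinite union of closed sets need not be closed, so continuity from above
      replaces it by a finite one.\<close>
    have "(\<lambda>n. measure M (?G - (\<Union>i<n. F i))) \<longlonglongrightarrow> measure M (\<Inter>n. ?G - (\<Union>i<n. F i))"
      using sets by (intro finite_Lim_measure_decseq) (auto simp: decseq_def dest: less_le_trans)
    also have "(\<Inter>n. ?G - (\<Union>i<n. F i)) = ?G - (\<Union>i. F i)" by auto
    finally have "eventually (\<lambda>n. measure M (?G - (\<Union>i<n. F i)) < e) sequentially"
      by (rule order_tendstoD) (use le Union.prems in linarith)
    then obtain n where "measure M (?G - (\<Union>i<n. F i)) < e" by (auto simp: eventually_sequentially)
    moreover have "closed (\<Union>i<n. F i)" "open ?G" using FG by auto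
    moreover have "(\<Union>i<n. F i) \<subseteq> (\<Union>i. A i)" "(\<Union>i. A i) \<subseteq> ?G" using FG(3,4) by (intro UN_mono subset_UNIV; simp)+
    ultimately show ?case by (intro exI conjI)
  qed
qed

text \<open>A Borel hull of \<open>E\<close> is approximated with respect to \<mu> restricted to
  \<open>U\<close>, which is a finite measure, and the open set obtained is cut down to
  \<open>U\<close>.\<close>

lemma borel_regular_open_approx:
  fixes \<mu> :: "'a::metric_space set \<Rightarrow> ennreal"
  assumes \<mu>: "measure_over \<mu>" "borel_regular \<mu>" and U: "open U" "\<mu> U < \<infinity>" and E: "E \<subseteq> U" and e: "0 < (e::real)"
  obtains V where "open V" "E \<subseteq> V" "V \<subseteq> U" "\<mu> V \<le> \<mu> E + ennreal e"
proof -
  obtain B where B: "B \<in> sets borel" "E \<subseteq> B" "\<mu> B = \<mu> E"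
    using \<mu>(2) unfolding borel_regular_def by blast
  \<comment> \<open>Pushing forward along the identity leaves a measure on exactly the Borel sets of
    the whole space, as \<open>finite_borel_measure_approx\<close> demands.\<close>
  define M where "M = distr (restrict_space (caratheodory_measure \<mu>) U) borel id"
  have borel: "A \<in> sets borel \<Longrightarrow> A \<in> sets (caratheodory_measure \<mu>)" for A
    by (simp add: sets_caratheodory_measure[OF \<mu>(1)] borel_caratheodory_sets[OF \<mu>(2)])
  have meas: "id \<in> restrict_space (caratheodory_measure \<mu>) U \<rightarrow>\<^sub>M borel"
    using borel U by (auto simp: measurable_def space_restrict_space sets_restrict_space)
  have emeasure_M: "emeasure M A = \<mu> (A \<inter> U)" if "A \<in> sets borel" for A
  proof -
    have "emeasure M A = emeasure (restrict_space (caratheodory_measure \<mu>) U) (A \<inter> U)"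
      unfolding M_def using meas that by (simp add: emeasure_distr space_restrict_space)
    also have "\<dots> = emeasure (caratheodory_measure \<mu>) (A \<inter> U)"
      using borel U by (intro emeasure_restrict_space) auto
    also have "\<dots> = \<mu> (A \<inter> U)"
      using that U by (intro emeasure_caratheodory_measure[OF \<mu>(1)] borel_caratheodory_sets[OF \<mu>(2)]) auto
    finally show ?thesis .
  qed
  have fin: "finite_measure M"
    using U emeasure_M[of UNIV] by (intro finite_measureI) (auto simp: M_def less_top)
  interpret finite_measure M by fact
  obtain F G where FG: "closed F" "open G" "F \<subseteq> B" "B \<subseteq> G" "measure M (G - F) < e"
    using finite_borel_measure_approx[OF fin _ B(1) e] by (auto simp: M_def)
  have "\<mu> (G \<inter> U) \<le> \<mu> (B \<union> ((G - F) \<inter> U))"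
    using FG by (intro measure_over_mono[OF \<mu>(1)]) auto
  also have "\<dots> \<le> \<mu> B + \<mu> ((G - F) \<inter> U)" by (rule measure_over_Un[OF \<mu>(1)])
  also have "\<mu> ((G - F) \<inter> U) = emeasure M (G - F)" using FG by (intro emeasure_M[symmetric]) auto
  also have "\<dots> \<le> ennreal e" using FG(5) by (simp add: emeasure_eq_measure ennreal_leI)
  finally have "\<mu> (G \<inter> U) \<le> \<mu> E + ennreal e" by (simp add: B add_left_mono)
  then show ?thesis
    using FG B E U by (intro that[of "G \<inter> U"]) auto
qed

section \<open>Hausdorff measure\<close>

lemma dist_le_ediam: "x \<in> S \<Longrightarrow> y \<in> S \<Longrightarrow> ennreal (dist x y) \<le> ediam S"
  unfolding ediam_def by (rule SUP_upper2[of "(x, y)"]) auto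

lemma ediam_le: "(\<And>x y. x \<in> S \<Longrightarrow> y \<in> S \<Longrightarrow> ennreal (dist x y) \<le> r) \<Longrightarrow> ediam S \<le> r"
  unfolding ediam_def by (rule SUP_least) auto

lemma ediam_le_ennrealD: "ediam S \<le> ennreal r \<Longrightarrow> 0 \<le> r \<Longrightarrow> x \<in> S \<Longrightarrow> y \<in> S \<Longrightarrow> dist x y \<le> r"
  using order_trans[OF dist_le_ediam[of x S y], of "ennreal r"] by (simp add: ennreal_le_iff)

lemma ediam_empty [simp]: "ediam {} = 0"
  by (simp add: ediam_def bot_ennreal)

text \<open>Closed balls are closed, so the bound passes to the closure in one variable at a
  time.\<close>

lemma ediam_closure_le:
  assumes r: "0 \<le> r" and S: "\<And>x y. x \<in> S \<Longrightarrow> y \<in> S \<Longrightarrow> dist x y \<le> r"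
  shows "ediam (closure S) \<le> ennreal r"
proof (rule ediam_le)
  have *: "closure S \<subseteq> cball x r" if "x \<in> S" for x
    using S that by (intro closure_minimal) (auto simp: mem_cball)
  then have "S \<subseteq> cball y r" if "y \<in> closure S" for y
    using that by (fastforce simp: mem_cball dist_commute)
  then have "closure S \<subseteq> cball y r" if "y \<in> closure S" for y
    using that by (intro closure_minimal) auto
  then show "ennreal (dist x y) \<le> ennreal r" if "x \<in> closure S" "y \<in> closure S" for x y
    using that by (intro ennreal_leI) (metis dist_commute mem_cball subsetD)
qed

lemma hzeta_empty [simp]: "hzeta c \<alpha> {} = 0"
  by (simp add: hzeta_def)

lemma hzeta_finite: "ediam S < \<infinity> \<Longrightarrow> hzeta c \<alpha> S < \<infinity>"
  by (auto simp: hzeta_def)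

lemma hzeta_le_of_ediam_le:
  assumes c: "0 < c" and \<alpha>: "0 < \<alpha>" and r: "0 \<le> r" and T: "ediam T < \<infinity>"
    and le: "ediam S \<le> ennreal r * ediam T"
  shows "hzeta c \<alpha> S \<le> ennreal (r powr \<alpha>) * hzeta c \<alpha> T"
proof -
  obtain t where t: "ediam T = ennreal t" "0 \<le> t"
    using T by (cases "ediam T") auto
  have le': "ediam S \<le> ennreal (r * t)" using le r t by (simp add: ennreal_mult)
  then obtain s where s: "ediam S = ennreal s" "0 \<le> s" by (cases "ediam S") (auto simp: top_unique)
  have "s \<le> r * t" using le' s r t by simp
  then have "s powr \<alpha> \<le> (r * t) powr \<alpha>" using s \<alpha> by (intro powr_mono2) auto
  then have "c * s powr \<alpha> \<le> r powr \<alpha> * (c * t powr \<alpha>)"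
    using c by (simp add: powr_mult r t mult.left_commute mult_left_mono)
  then have "ennreal (c * s powr \<alpha>) \<le> ennreal (r powr \<alpha> * (c * t powr \<alpha>))" by (rule ennreal_leI)
  then show ?thesis by (simp add: hzeta_def s t ennreal_mult')
qed

section \<open>Premeasures at a fixed scale and their supremum\<close>

definition hausdorff_pre :: "real \<Rightarrow> real \<Rightarrow> real \<Rightarrow> 'a::metric_space set \<Rightarrow> ennreal" where
  "hausdorff_pre c \<alpha> \<delta> R =
     (INF E \<in> {E :: nat \<Rightarrow> 'a set. (\<forall>j. closed (E j) \<and> ediam (E j) \<le> ennreal \<delta>) \<and> R \<subseteq> (\<Union>j. E j)}.
        \<Sum>j. hzeta c \<alpha> (E j))"

lemma hausdorff_measure_eq_SUP:
  "hausdorff_measure c \<alpha> R = (SUP \<delta>\<in>{0<..}. hausdorff_pre c \<alpha> \<delta> R)"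
  by (simp add: hausdorff_measure_def hausdorff_pre_def)

lemma hausdorff_pre_le_measure: "0 < \<delta> \<Longrightarrow> hausdorff_pre c \<alpha> \<delta> R \<le> hausdorff_measure c \<alpha> R"
  by (auto simp: hausdorff_measure_eq_SUP intro: SUP_upper)

lemma hausdorff_measure_le:
  "(\<And>\<delta>. 0 < \<delta> \<Longrightarrow> hausdorff_pre c \<alpha> \<delta> R \<le> h) \<Longrightarrow> hausdorff_measure c \<alpha> R \<le> h"
  by (auto simp: hausdorff_measure_eq_SUP intro: SUP_least)

lemma hausdorff_pre_le:
  "(\<And>j. closed (E j)) \<Longrightarrow> (\<And>j. ediam (E j) \<le> ennreal \<delta>) \<Longrightarrow> R \<subseteq> (\<Union>j. E j) \<Longrightarrow>
    hausdorff_pre c \<alpha> \<delta> R \<le> (\<Sum>j. hzeta c \<alpha> (E j))"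
  unfolding hausdorff_pre_def by (rule INF_lower) auto

lemma hausdorff_pre_less:
  assumes "hausdorff_pre c \<alpha> \<delta> R < h"
  obtains E where "\<And>j. closed (E j)" "\<And>j. ediam (E j) \<le> ennreal \<delta>" "R \<subseteq> (\<Union>j. E j)"
    "(\<Sum>j. hzeta c \<alpha> (E j)) < h"
  using assms unfolding hausdorff_pre_def INF_less_iff by blast

lemma hausdorff_pre_mono: "S \<subseteq> T \<Longrightarrow> hausdorff_pre c \<alpha> \<delta> S \<le> hausdorff_pre c \<alpha> \<delta> T"
  unfolding hausdorff_pre_def by (rule INF_superset_mono) auto

lemma hausdorff_pre_antimono:
  assumes "\<delta> \<le> \<delta>'"
  shows "hausdorff_pre c \<alpha> \<delta>' S \<le> hausdorff_pre c \<alpha> \<delta> S"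
  unfolding hausdorff_pre_def
  using order_trans[OF _ ennreal_leI[OF assms]] by (intro INF_superset_mono) blast+

lemma hausdorff_pre_empty [simp]: "hausdorff_pre c \<alpha> \<delta> {} = 0"
  using hausdorff_pre_le[of "\<lambda>_. {}" \<delta> "{}" c \<alpha>] by simp

text \<open>Covers of the sets \<open>R n\<close>, optimal up to \<open>e * (1/2) ^ Suc n\<close>,
  are merged into one sequence by the pairing bijection \<open>prod_decode\<close>; their errors
  total \<open>e\<close>.\<close>

lemma hausdorff_pre_UN:
  "hausdorff_pre c \<alpha> \<delta> (\<Union>n. R n) \<le> (\<Sum>n. hausdorff_pre c \<alpha> \<delta> (R n))"
proof (rule ennreal_le_epsilon)
  fix e :: real assume fin: "(\<Sum>n. hausdorff_pre c \<alpha> \<delta> (R n)) < top" and e: "0 < e"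
  have "\<exists>E. (\<forall>j. closed (E j) \<and> ediam (E j) \<le> ennreal \<delta>) \<and> R n \<subseteq> (\<Union>j. E j) \<and>
      (\<Sum>j. hzeta c \<alpha> (E j)) \<le> hausdorff_pre c \<alpha> \<delta> (R n) + ennreal e * ennreal ((1/2) ^ Suc n)" for n
  proof -
    have "hausdorff_pre c \<alpha> \<delta> (R n) \<noteq> \<infinity>"
      using fin ennreal_suminf_lessD less_top by fastforce
    then have "hausdorff_pre c \<alpha> \<delta> (R n) < hausdorff_pre c \<alpha> \<delta> (R n) + ennreal (e * (1/2) ^ Suc n)"
      using e by (auto intro!: ennreal_add_left_cancel_less[THEN iffD2] simp: ennreal_add_left_cancel_less)
    then obtain E where "\<And>j. closed (E j)" "\<And>j. ediam (E j) \<le> ennreal \<delta>" "R n \<subseteq> (\<Union>j. E j)"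
      "(\<Sum>j. hzeta c \<alpha> (E j)) < hausdorff_pre c \<alpha> \<delta> (R n) + ennreal (e * (1/2) ^ Suc n)"
      by (rule hausdorff_pre_less) blast
    then show ?thesis
      using e by (intro exI[of _ E]) (auto simp: less_imp_le simp flip: ennreal_mult')
  qed
  then obtain E where E: "\<And>n j. closed (E n j)" "\<And>n j. ediam (E n j) \<le> ennreal \<delta>"
    "\<And>n. R n \<subseteq> (\<Union>j. E n j)"
    "\<And>n. (\<Sum>j. hzeta c \<alpha> (E n j)) \<le> hausdorff_pre c \<alpha> \<delta> (R n) + ennreal e * ennreal ((1/2) ^ Suc n)"
    by metis
  let ?E = "\<lambda>i. case prod_decode i of (n, j) \<Rightarrow> E n j"
  have "(\<Union>n. R n) \<subseteq> (\<Union>i. ?E i)"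
  proof
    fix x assume "x \<in> (\<Union>n. R n)"
    then obtain n j where "x \<in> E n j" using E(3) by blast
    then show "x \<in> (\<Union>i. ?E i)" by (intro UN_I[of "prod_encode (n, j)"]) auto
  qed
  then have "hausdorff_pre c \<alpha> \<delta> (\<Union>n. R n) \<le> (\<Sum>i. hzeta c \<alpha> (?E i))"
    using E by (intro hausdorff_pre_le) (auto split: prod.split)
  also have "\<dots> = (\<Sum>i. (\<lambda>(n, j). hzeta c \<alpha> (E n j)) (prod_decode i))"
    by (auto intro!: suminf_cong split: prod.split)
  also have "\<dots> = (\<Sum>n. \<Sum>j. hzeta c \<alpha> (E n j))"
    by (rule suminf_ennreal_2dimen) simp
  also have "\<dots> \<le> (\<Sum>n. hausdorff_pre c \<alpha> \<delta> (R n) + ennreal e * ennreal ((1/2) ^ Suc n))"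
    by (intro suminf_le E summableI)
  also have "\<dots> = (\<Sum>n. hausdorff_pre c \<alpha> \<delta> (R n)) + (\<Sum>n. ennreal e * ennreal ((1/2) ^ Suc n))"
    by (rule suminf_add[symmetric]) auto
  also have "(\<Sum>n. ennreal e * ennreal ((1/2) ^ Suc n)) = ennreal e"
    unfolding ennreal_suminf_cmult
    by (subst suminf_ennreal_eq[OF zero_le_power power_half_series]) auto
  finally show "hausdorff_pre c \<alpha> \<delta> (\<Union>n. R n) \<le> (\<Sum>n. hausdorff_pre c \<alpha> \<delta> (R n)) + ennreal e" .
qed

lemma measure_over_hausdorff: "measure_over (hausdorff_measure c \<alpha> :: 'a::metric_space set \<Rightarrow> ennreal)"
  unfolding measure_over_def outer_measure_space_def
proof (intro conjI)
  show "positive (Pow UNIV) (hausdorff_measure c \<alpha>)"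
    by (auto simp: positive_def hausdorff_measure_eq_SUP)
  show "increasing (Pow UNIV) (hausdorff_measure c \<alpha>)"
    by (auto simp: increasing_def hausdorff_measure_eq_SUP intro!: SUP_mono' hausdorff_pre_mono)
  have sub: "hausdorff_measure c \<alpha> (\<Union>n. R n) \<le> (\<Sum>n. hausdorff_measure c \<alpha> (R n))" for R :: "nat \<Rightarrow> 'a set"
  proof (rule hausdorff_measure_le)
    fix \<delta> :: real assume "0 < \<delta>"
    have "hausdorff_pre c \<alpha> \<delta> (\<Union>n. R n) \<le> (\<Sum>n. hausdorff_pre c \<alpha> \<delta> (R n))"
      by (rule hausdorff_pre_UN)
    also have "\<dots> \<le> (\<Sum>n. hausdorff_measure c \<alpha> (R n))"
      using \<open>0 < \<delta>\<close> by (intro suminf_le hausdorff_pre_le_measure summableI)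
    finally show "hausdorff_pre c \<alpha> \<delta> (\<Union>n. R n) \<le> (\<Sum>n. hausdorff_measure c \<alpha> (R n))" .
  qed
  show "countably_subadditive (Pow UNIV) (hausdorff_measure c \<alpha> :: 'a set \<Rightarrow> ennreal)"
    unfolding countably_subadditive_def by (intro allI impI) (rule sub)
qed

text \<open>A set of diameter below \<open>r\<close> cannot meet both \<open>S\<close> and
  \<open>T\<close>, so a fine cover of the union splits into two covers without shared sets.\<close>

lemma hausdorff_measure_separated:
  assumes r: "0 < r" and sep: "\<And>x y. x \<in> S \<Longrightarrow> y \<in> T \<Longrightarrow> r \<le> dist x y"
  shows "hausdorff_measure c \<alpha> S + hausdorff_measure c \<alpha> T \<le> hausdorff_measure c \<alpha> (S \<union> T)"
proof -
  have pre: "hausdorff_pre c \<alpha> \<delta> S + hausdorff_pre c \<alpha> \<delta> T \<le> hausdorff_pre c \<alpha> \<delta> (S \<union> T)"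
    if \<delta>: "0 < \<delta>" "\<delta> < r" for \<delta>
    unfolding hausdorff_pre_def[of c \<alpha> \<delta> "S \<union> T"]
  proof (rule INF_greatest, safe)
    fix E :: "nat \<Rightarrow> 'a set"
    assume E: "\<forall>j. closed (E j) \<and> ediam (E j) \<le> ennreal \<delta>" "S \<union> T \<subseteq> (\<Union>j. E j)"
    \<comment> \<open>Sets missing \<open>R\<close> become empty, which costs nothing and keeps the
      indexing for the termwise comparison.\<close>
    define P where "P R j = (if E j \<inter> R = {} then {} else E j)" for R j
    have P: "hausdorff_pre c \<alpha> \<delta> R \<le> (\<Sum>j. hzeta c \<alpha> (P R j))" if "R \<subseteq> S \<union> T" for R
    proof (rule hausdorff_pre_le)
      show "R \<subseteq> (\<Union>j. P R j)"
        unfolding P_def using E(2) that by (fastforce split: if_splits)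
    qed (use E in \<open>auto simp: P_def\<close>)
    have disj: "E j \<inter> S = {} \<or> E j \<inter> T = {}" for j
    proof (rule ccontr)
      assume "\<not> ?thesis"
      then obtain x y where xy: "x \<in> E j" "x \<in> S" "y \<in> E j" "y \<in> T" by blast
      have "dist x y \<le> \<delta>"
        using E(1) \<delta> xy by (intro ediam_le_ennrealD[of "E j"]) auto
      then show False using sep[of x y] xy \<delta> by simp
    qed
    have "hausdorff_pre c \<alpha> \<delta> S + hausdorff_pre c \<alpha> \<delta> T
        \<le> (\<Sum>j. hzeta c \<alpha> (P S j)) + (\<Sum>j. hzeta c \<alpha> (P T j))"
      by (intro add_mono P) auto
    also have "\<dots> = (\<Sum>j. hzeta c \<alpha> (P S j) + hzeta c \<alpha> (P T j))"
      by (rule suminf_add) auto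
    also have "\<dots> \<le> (\<Sum>j. hzeta c \<alpha> (E j))"
      using disj by (intro suminf_le summableI) (auto simp: P_def)
    finally show "hausdorff_pre c \<alpha> \<delta> S + hausdorff_pre c \<alpha> \<delta> T \<le> (\<Sum>j. hzeta c \<alpha> (E j))" .
  qed
  have "hausdorff_pre c \<alpha> \<delta> S + hausdorff_pre c \<alpha> \<delta>' T \<le> hausdorff_measure c \<alpha> (S \<union> T)"
    if "0 < \<delta>" "0 < \<delta>'" for \<delta> \<delta>'
  proof -
    \<comment> \<open>One scale below both and strictly below \<open>r\<close> serves, since the
      premeasures grow as the scale shrinks. With independent scales the two suprema can then be
      taken one after the other.\<close>
    define d where "d = min (min \<delta> \<delta>') (r / 2)"
    have d: "0 < d" "d < r" "d \<le> \<delta>" "d \<le> \<delta>'" using that r by (auto simp: d_def)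
    have "hausdorff_pre c \<alpha> \<delta> S + hausdorff_pre c \<alpha> \<delta>' T \<le> hausdorff_pre c \<alpha> d S + hausdorff_pre c \<alpha> d T"
      using d by (intro add_mono hausdorff_pre_antimono)
    also have "\<dots> \<le> hausdorff_pre c \<alpha> d (S \<union> T)" using d by (intro pre)
    also have "\<dots> \<le> hausdorff_measure c \<alpha> (S \<union> T)" using d by (intro hausdorff_pre_le_measure)
    finally show ?thesis .
  qed
  then have "(SUP \<delta>\<in>{0<..}. SUP \<delta>'\<in>{0<..}. hausdorff_pre c \<alpha> \<delta> S + hausdorff_pre c \<alpha> \<delta>' T)
      \<le> hausdorff_measure c \<alpha> (S \<union> T)"
    by (auto intro!: SUP_least)
  also have "(SUP \<delta>\<in>{0::real<..}. SUP \<delta>'\<in>{0::real<..}. hausdorff_pre c \<alpha> \<delta> S + hausdorff_pre c \<alpha> \<delta>' T)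
      = (SUP \<delta>\<in>{0<..}. hausdorff_pre c \<alpha> \<delta> S + hausdorff_measure c \<alpha> T)"
    unfolding hausdorff_measure_eq_SUP by (intro SUP_cong refl ennreal_SUP_add_right[symmetric]) auto
  also have "\<dots> = hausdorff_measure c \<alpha> S + hausdorff_measure c \<alpha> T"
    unfolding hausdorff_measure_eq_SUP by (intro ennreal_SUP_add_left) auto
  finally show ?thesis .
qed

text \<open>Borel sets are measurable by Caratheodory's criterion. For a set of finite measure, the
  hull intersects the unions of nearly optimal closed covers at scales tending to 0: each of these
  covers also covers the hull.\<close>

lemma borel_regular_hausdorff: "borel_regular (hausdorff_measure c \<alpha> :: 'a::metric_space set \<Rightarrow> ennreal)"
  unfolding borel_regular_def
proof safe
  fix B :: "'a set" assume "B \<in> sets borel"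
  then show "B \<in> caratheodory_sets (hausdorff_measure c \<alpha>)"
    by (intro metric_outer_measure_borel[OF measure_over_hausdorff] hausdorff_measure_separated)
next
  fix R :: "'a set"
  show "\<exists>B\<in>sets borel. R \<subseteq> B \<and> hausdorff_measure c \<alpha> B = hausdorff_measure c \<alpha> R"
  proof (cases "hausdorff_measure c \<alpha> R = \<infinity>")
    case True
    then show ?thesis
      using measure_over_mono[OF measure_over_hausdorff, of R UNIV c \<alpha>]
      by (intro bexI[of _ UNIV]) (auto simp: top_unique)
  next
    case False
    define u where "u n = inverse (real (Suc n))" for n
    have u: "u n > 0" for n by (simp add: u_def)
    have "\<exists>E. (\<forall>j. closed (E j) \<and> ediam (E j) \<le> ennreal (u n)) \<and> R \<subseteq> (\<Union>j. E j) \<and>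
        (\<Sum>j. hzeta c \<alpha> (E j)) \<le> hausdorff_measure c \<alpha> R + ennreal (u n)" for n
    proof -
      have "hausdorff_pre c \<alpha> (u n) R \<le> hausdorff_measure c \<alpha> R"
        using u by (rule hausdorff_pre_le_measure)
      also have "\<dots> < hausdorff_measure c \<alpha> R + ennreal (u n)"
        using u[of n] False by (auto simp: ennreal_add_left_cancel_less)
      finally show ?thesis by (rule hausdorff_pre_less) (blast intro: less_imp_le)
    qed
    then obtain E where E: "\<And>n j. closed (E n j)" "\<And>n j. ediam (E n j) \<le> ennreal (u n)"
      "\<And>n. R \<subseteq> (\<Union>j. E n j)"
      "\<And>n. (\<Sum>j. hzeta c \<alpha> (E n j)) \<le> hausdorff_measure c \<alpha> R + ennreal (u n)"
      by metis
    define B where "B = (\<Inter>n. \<Union>j. E n j)"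
    have "B \<in> sets borel"
      unfolding B_def using E(1) by (intro sets.countable_INT'' sets.countable_UN') auto
    moreover have R: "R \<subseteq> B" using E(3) by (auto simp: B_def)
    moreover have "hausdorff_measure c \<alpha> B \<le> hausdorff_measure c \<alpha> R"
    proof (rule hausdorff_measure_le, rule ennreal_le_epsilon)
      fix \<delta> e :: real assume "0 < \<delta>" "0 < e"
      then obtain n where n: "u n < min \<delta> e"
        unfolding u_def using reals_Archimedean[of "min \<delta> e"] by auto
      have "hausdorff_pre c \<alpha> \<delta> B \<le> hausdorff_pre c \<alpha> (u n) B"
        using n by (intro hausdorff_pre_antimono) auto
      also have "\<dots> \<le> (\<Sum>j. hzeta c \<alpha> (E n j))"
        using E by (intro hausdorff_pre_le) (auto simp: B_def)
      also have "\<dots> \<le> hausdorff_measure c \<alpha> R + ennreal (u n)" by (rule E)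
      also have "\<dots> \<le> hausdorff_measure c \<alpha> R + ennreal e"
        using n by (intro add_left_mono ennreal_leI) auto
      finally show "hausdorff_pre c \<alpha> \<delta> B \<le> hausdorff_measure c \<alpha> R + ennreal e" .
    qed
    ultimately show ?thesis
      using measure_over_mono[OF measure_over_hausdorff R, of c \<alpha>] by (intro bexI[of _ B]) auto
  qed
qed

section \<open>Disjoint selection\<close>

text \<open>Zorn's lemma gives a maximal disjoint \<open>G\<close> such that every member of
  \<open>F\<close> meeting \<open>G\<close> meets a member at least half its size. If some members
  of \<open>F\<close> missed \<open>G\<close>, a nearly largest one of them could be added.\<close>

lemma vitali_selection:
  fixes F :: "'a set set" and d :: "'a set \<Rightarrow> real"
  assumes ne: "{} \<notin> F" and bound: "\<And>S. S \<in> F \<Longrightarrow> 0 \<le> d S \<and> d S \<le> R"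
  obtains G where "G \<subseteq> F" "disjoint G"
    "\<And>S. S \<in> F \<Longrightarrow> \<exists>T\<in>G. S \<inter> T \<noteq> {} \<and> d S \<le> 2 * d T"
proof -
  define \<Omega> where "\<Omega> = {G. G \<subseteq> F \<and> disjoint G \<and>
    (\<forall>S\<in>F. (\<exists>T\<in>G. S \<inter> T \<noteq> {}) \<longrightarrow> (\<exists>T\<in>G. S \<inter> T \<noteq> {} \<and> d S \<le> 2 * d T))}"
  have "\<Union>C \<in> \<Omega>" if C: "subset.chain \<Omega> C" for C
  proof -
    have sub: "C \<subseteq> \<Omega>" and lin: "\<And>X Y. X \<in> C \<Longrightarrow> Y \<in> C \<Longrightarrow> X \<subseteq> Y \<or> Y \<subseteq> X"
      using C by (auto simp: subset_chain_def)
    have "disjoint (\<Union>C)"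
      unfolding disjoint_def
    proof (intro ballI impI)
      fix S T assume "S \<in> \<Union>C" "T \<in> \<Union>C" "S \<noteq> T"
      then obtain X Y where "X \<in> C" "S \<in> X" "Y \<in> C" "T \<in> Y" by blast
      then obtain Z where Z: "Z \<in> C" "S \<in> Z" "T \<in> Z" using lin[of X Y] by blast
      then have "disjoint Z" using sub by (auto simp: \<Omega>_def)
      then show "S \<inter> T = {}" using Z \<open>S \<noteq> T\<close> by (simp add: disjoint_def)
    qed
    moreover have "\<Union>C \<subseteq> F" using sub by (auto simp: \<Omega>_def)
    moreover have "\<exists>T\<in>\<Union>C. S \<inter> T \<noteq> {} \<and> d S \<le> 2 * d T"
      if S: "S \<in> F" "\<exists>T\<in>\<Union>C. S \<inter> T \<noteq> {}" for S
    proof -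
      obtain X T where X: "X \<in> C" "T \<in> X" "S \<inter> T \<noteq> {}" using S(2) by blast
      then have "X \<in> \<Omega>" using sub by blast
      then show ?thesis using X S(1) unfolding \<Omega>_def by blast
    qed
    ultimately show ?thesis by (simp add: \<Omega>_def)
  qed
  from subset_Zorn'[of \<Omega>, OF this]
  obtain G where G: "G \<in> \<Omega>" and max: "\<And>X. X \<in> \<Omega> \<Longrightarrow> G \<subseteq> X \<Longrightarrow> X = G" by blast
  define F' where "F' = {S\<in>F. \<forall>T\<in>G. S \<inter> T = {}}"
  have "F' = {}"
  proof (rule ccontr)
    assume "F' \<noteq> {}"
    have bdd: "bdd_above (d ` F')" using bound by (intro bdd_aboveI2[of _ d R]) (auto simp: F'_def)
    \<comment> \<open>If \<open>d\<close> vanishes on \<open>F'\<close> any member serves. Otherwise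
      half the supremum is strictly below it and is exceeded by some \<open>d S0\<close>.\<close>
    have "\<exists>S0\<in>F'. \<forall>S\<in>F'. d S \<le> 2 * d S0"
    proof (cases "\<exists>S\<in>F'. 0 < d S")
      case False
      then show ?thesis using bound \<open>F' \<noteq> {}\<close> by (force simp: F'_def)
    next
      case True
      then have pos: "0 < Sup (d ` F')" using bdd \<open>F' \<noteq> {}\<close> by (auto simp: less_cSup_iff)
      then have "Sup (d ` F') / 2 < Sup (d ` F')" by simp
      from less_cSupD[OF _ this] obtain S0 where "S0 \<in> F'" "Sup (d ` F') / 2 < d S0"
        using \<open>F' \<noteq> {}\<close> by blast
      moreover have "d S \<le> Sup (d ` F')" if "S \<in> F'" for S
        using bdd that by (intro cSup_upper) auto
      ultimately show ?thesis by (intro bexI[of _ S0]) force+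
    qed
    then obtain S0 where S0: "S0 \<in> F'" "\<And>S. S \<in> F' \<Longrightarrow> d S \<le> 2 * d S0" by blast
    have "insert S0 G \<in> \<Omega>"
      unfolding \<Omega>_def
    proof (intro CollectI conjI ballI impI)
      show "insert S0 G \<subseteq> F" using G S0 by (auto simp: \<Omega>_def F'_def)
      show "disjoint (insert S0 G)"
        using G S0 by (auto simp: \<Omega>_def F'_def disjoint_def)
      fix S assume S: "S \<in> F" "\<exists>T\<in>insert S0 G. S \<inter> T \<noteq> {}"
      show "\<exists>T\<in>insert S0 G. S \<inter> T \<noteq> {} \<and> d S \<le> 2 * d T"
      proof (cases "\<exists>T\<in>G. S \<inter> T \<noteq> {}")
        case True
        then show ?thesis using G S by (auto simp: \<Omega>_def)
      next
        case False
        then have "S \<in> F'" using S by (auto simp: F'_def)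
        then show ?thesis using S False S0(2) by auto
      qed
    qed
    then have "S0 \<in> G" using max by blast
    then show False using S0 ne by (auto simp: F'_def)
  qed
  then show ?thesis
    using G by (intro that[of G]) (auto simp: \<Omega>_def F'_def)
qed

text \<open>Disjointness bounds all finite sums of measures by that of \<open>V\<close>, so the
  family is summable, and a summable family has only countably many nonzero terms.\<close>

lemma countable_disjoint_positive_emeasure:
  assumes G: "disjoint G" "G \<subseteq> sets M" "\<Union>G \<subseteq> V" and V: "V \<in> sets M" "emeasure M V < \<infinity>"
    and pos: "\<And>S. S \<in> G \<Longrightarrow> emeasure M S \<noteq> 0"
  shows "countable G"
proof -
  have le: "sum (emeasure M) X \<le> emeasure M V" if "X \<subseteq> G" "finite X" for X
  proof -
    have "sum (emeasure M) X = emeasure M (\<Union>S\<in>X. S)"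
      using that G by (intro sum_emeasure) (auto simp: disjoint_family_on_def disjoint_def subset_iff)
    also have "\<dots> \<le> emeasure M V" using that G V by (intro emeasure_mono) auto
    finally show ?thesis .
  qed
  have fin: "emeasure M S < \<infinity>" if "S \<in> G" for S
    using le[of "{S}"] that V by (auto intro: le_less_trans)
  have "sum (measure M) X \<le> measure M V" if "X \<subseteq> G" "finite X" for X
  proof -
    have "ennreal (sum (measure M) X) = sum (emeasure M) X"
      using that fin
      by (auto intro!: sum.cong simp: sum_ennreal[symmetric] emeasure_eq_ennreal_measure less_top subset_iff simp del: sum_ennreal)
    also have "\<dots> \<le> ennreal (measure M V)"
      using le[OF that] V by (simp add: emeasure_eq_ennreal_measure less_top)
    finally show ?thesis by (simp add: ennreal_le_iff)
  qed
  then have "measure M summable_on G"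
    by (intro nonneg_bdd_above_summable_on) (auto intro!: bdd_aboveI)
  then have "countable {S\<in>G. measure M S \<noteq> 0}" by (rule summable_countable_real)
  also have "{S\<in>G. measure M S \<noteq> 0} = G"
    using pos fin by (auto simp: measure_def enn2real_eq_0_iff less_top)
  finally show ?thesis .
qed

section \<open>Density comparison\<close>

text \<open>If \<open>\<zeta> S = 0\<close>, admissibility makes \<open>\<mu> S\<close> positive; if
  \<open>\<zeta> S\<close> is infinite, the quotient is 0 and cannot exceed
  \<open>ennreal t\<close>.\<close>

lemma less_quotientD:
  assumes S: "S \<in> admissible_sets \<mu> \<zeta>" and t: "ennreal t < quotient_fun \<mu> \<zeta> S"
  shows "ennreal t * \<zeta> S < \<mu> S"
proof -
  consider "\<zeta> S = 0" "\<mu> S \<noteq> 0" | "\<zeta> S \<noteq> 0" "\<zeta> S < \<infinity>" "ennreal t < \<mu> S / \<zeta> S"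
    using S t by (auto simp: admissible_sets_def quotient_fun_def split: if_splits)
  then show ?thesis
  proof cases
    case 2
    show ?thesis
    proof (rule ccontr)
      assume "\<not> ?thesis"
      then have "\<mu> S / \<zeta> S \<le> ennreal t * \<zeta> S / \<zeta> S"
        by (intro divide_right_mono_ennreal) simp
      also have "\<dots> = ennreal t" using 2 by (intro ennreal_mult_divide_eq) auto
      finally show False using 2 by simp
    qed
  qed (auto simp: zero_less_iff_neq_zero)
qed

text \<open>A closed set with finite \<zeta> is inadmissible only if \<zeta> and \<mu> both vanish
  on it, where the bound is trivial. Thus covers by arbitrary closed sets of finite diameter can be
  used.\<close>

lemma quotient_leD:
  assumes S: "closed S" "\<zeta> S < \<infinity>"
    and t: "S \<in> admissible_sets \<mu> \<zeta> \<Longrightarrow> quotient_fun \<mu> \<zeta> S \<le> ennreal t"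
  shows "\<mu> S \<le> ennreal t * \<zeta> S"
proof (cases "S \<in> admissible_sets \<mu> \<zeta>")
  case False
  then show ?thesis using S by (auto simp: admissible_sets_def)
next
  case True
  then have \<zeta>: "\<zeta> S \<noteq> 0" "\<mu> S / \<zeta> S \<le> ennreal t"
    using t S by (auto simp: quotient_fun_def top_unique split: if_splits)
  have "\<mu> S = \<mu> S / \<zeta> S * \<zeta> S"
    using \<zeta> S by (simp add: ennreal_divide_times ennreal_mult_divide_eq)
  also have "\<dots> \<le> ennreal t * \<zeta> S" using \<zeta> by (intro mult_right_mono) auto
  finally show ?thesis .
qed

text \<open>\<open>Bk k\<close> collects the points where the quotient bound holds for all
  admissible sets of diameter below \<open>u k\<close>. Covers of \<open>Bk k\<close> at a finer
  scale can be estimated set by set, and \<open>k\<close> then tends to infinity.\<close>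

lemma density_upper:
  fixes \<mu> :: "'a::metric_space set \<Rightarrow> ennreal"
  assumes \<mu>: "measure_over \<mu>" "borel_regular \<mu>" and t: "0 < t"
    and B: "\<And>x. x \<in> B \<Longrightarrow> federer_density c \<alpha> \<mu> x < ennreal t"
  shows "\<mu> B \<le> ennreal t * hausdorff_measure c \<alpha> B"
proof -
  let ?\<zeta> = "hzeta c \<alpha> :: 'a set \<Rightarrow> ennreal"
  define u where "u k = inverse (real (Suc k))" for k
  define Bk where "Bk k = {x\<in>B. \<forall>S\<in>admissible_sets \<mu> ?\<zeta>. x \<in> S \<longrightarrow> ediam S < ennreal (u k) \<longrightarrow>
     quotient_fun \<mu> ?\<zeta> S \<le> ennreal t}" for k
  have u: "0 < u k" "i \<le> k \<Longrightarrow> u k \<le> u i" for i k by (auto simp: u_def)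
  have "B \<subseteq> (\<Union>k. Bk k)"
  proof
    fix x assume "x \<in> B"
    from B[OF this] obtain e where e: "0 < e"
      "(SUP S\<in>{S \<in> admissible_sets \<mu> ?\<zeta>. x \<in> S \<and> ediam S < ennreal e}. quotient_fun \<mu> ?\<zeta> S) < ennreal t"
      by (auto simp: federer_density_def INF_less_iff)
    obtain k where k: "u k < e" unfolding u_def using reals_Archimedean[OF e(1)] by blast
    have "x \<in> Bk k"
      unfolding Bk_def
    proof (intro CollectI conjI ballI impI \<open>x \<in> B\<close>)
      fix S assume S: "S \<in> admissible_sets \<mu> ?\<zeta>" "x \<in> S" "ediam S < ennreal (u k)"
      have "ediam S < ennreal e" using order_less_le_trans[OF S(3) ennreal_leI] k by simp
      then have "quotient_fun \<mu> ?\<zeta> S \<le> (SUP S\<in>{S \<in> admissible_sets \<mu> ?\<zeta>. x \<in> S \<and> ediam S < ennreal e}. quotient_fun \<mu> ?\<zeta> S)"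
        using S by (intro SUP_upper) auto
      then show "quotient_fun \<mu> ?\<zeta> S \<le> ennreal t" using e(2) by simp
    qed
    then show "x \<in> (\<Union>k. Bk k)" by blast
  qed
  then have "\<mu> B \<le> \<mu> (\<Union>k. Bk k)" by (rule measure_over_mono[OF \<mu>(1)])
  \<comment> \<open>The sets \<open>Bk k\<close> need not be measurable; continuity from below holds
    because \<mu> is an outer measure with Borel hulls.\<close>
  also have "\<dots> = (SUP k. \<mu> (Bk k))"
  proof -
    have "incseq Bk"
      unfolding incseq_def Bk_def using order_less_le_trans[OF _ ennreal_leI[OF u(2)]] by blast
    then show ?thesis
      using SUP_outer_measure_of_incseq[of Bk "caratheodory_measure \<mu>"]
      by (simp add: borel_regular_outer[OF \<mu>])
  qed
  also have "\<dots> \<le> ennreal t * hausdorff_measure c \<alpha> B"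
  proof (rule SUP_least)
    fix k
    \<comment> \<open>Halving \<open>u k\<close> turns the weak diameter bound of covers into the
      strict one in \<open>Bk\<close>.\<close>
    have "\<mu> (Bk k) / ennreal t \<le> hausdorff_pre c \<alpha> (u k / 2) (Bk k)"
      unfolding hausdorff_pre_def
    proof (rule INF_greatest, safe)
      fix E :: "nat \<Rightarrow> 'a set"
      assume E: "\<forall>j. closed (E j) \<and> ediam (E j) \<le> ennreal (u k / 2)" "Bk k \<subseteq> (\<Union>j. E j)"
      \<comment> \<open>The quotient bound is known only for sets containing a point of
        \<open>Bk k\<close>, so the others are discarded.\<close>
      define P where "P j = (if E j \<inter> Bk k = {} then {} else E j)" for j
      have "\<mu> (P j) \<le> ennreal t * ?\<zeta> (E j)" for j
      proof (cases "E j \<inter> Bk k = {}")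
        case True
        then show ?thesis using \<mu> by (simp add: P_def)
      next
        case False
        then obtain x where x: "x \<in> E j" "x \<in> Bk k" by blast
        have "ediam (E j) \<le> ennreal (u k / 2)" using E by blast
        also have "\<dots> < ennreal (u k)" using u[of k] by (simp add: ennreal_less_iff)
        finally have d: "ediam (E j) < ennreal (u k)" .
        then have "?\<zeta> (E j) < \<infinity>" by (intro hzeta_finite) (auto intro: less_trans)
        then have "\<mu> (E j) \<le> ennreal t * ?\<zeta> (E j)"
          using E x d by (intro quotient_leD) (auto simp: Bk_def)
        then show ?thesis using False by (simp add: P_def)
      qed
      note le = this
      have "\<mu> (Bk k) \<le> \<mu> (\<Union>j. P j)"
        using E(2) by (intro measure_over_mono[OF \<mu>(1)]) (fastforce simp: P_def)
      also have "\<dots> \<le> (\<Sum>j. \<mu> (P j))" by (rule measure_over_UN[OF \<mu>(1)])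
      also have "\<dots> \<le> (\<Sum>j. ennreal t * ?\<zeta> (E j))" by (intro suminf_le le summableI)
      also have "\<dots> = (\<Sum>j. ?\<zeta> (E j)) * ennreal t" by (simp add: mult.commute)
      finally show "\<mu> (Bk k) / ennreal t \<le> (\<Sum>j. ?\<zeta> (E j))"
        using t by (metis divide_right_mono_ennreal ennreal_eq_0_iff ennreal_mult_divide_eq ennreal_neq_top not_le)
    qed
    also have "\<dots> \<le> hausdorff_measure c \<alpha> (Bk k)" using u by (intro hausdorff_pre_le_measure) simp
    also have "\<dots> \<le> hausdorff_measure c \<alpha> B"
      by (rule measure_over_mono[OF measure_over_hausdorff]) (auto simp: Bk_def)
    finally have "ennreal t * (\<mu> (Bk k) / ennreal t) \<le> ennreal t * hausdorff_measure c \<alpha> B"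
      by (rule mult_left_mono) simp
    also have "ennreal t * (\<mu> (Bk k) / ennreal t) = \<mu> (Bk k)"
      using t by (simp add: ennreal_times_divide mult.commute[of "ennreal t"] ennreal_mult_divide_eq)
    finally show "\<mu> (Bk k) \<le> ennreal t * hausdorff_measure c \<alpha> B" .
  qed
  finally show ?thesis .
qed

lemma less_densityD:
  assumes "ennreal t < federer_density c \<alpha> \<mu> x" and e: "0 < e"
  obtains S where "closed S" "x \<in> S" "ediam S < ennreal e" "ennreal t * hzeta c \<alpha> S < \<mu> S"
proof -
  have "ennreal t < (SUP S \<in> {S \<in> admissible_sets \<mu> (hzeta c \<alpha>). x \<in> S \<and> ediam S < ennreal e}.
      quotient_fun \<mu> (hzeta c \<alpha>) S)"
    using assms(1) unfolding federer_density_def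
    by (rule less_le_trans) (use e in \<open>auto intro: INF_lower\<close>)
  then obtain S where "S \<in> admissible_sets \<mu> (hzeta c \<alpha>)" "x \<in> S" "ediam S < ennreal e"
    "ennreal t < quotient_fun \<mu> (hzeta c \<alpha>) S"
    by (auto simp: less_SUP_iff)
  then show ?thesis
    using less_quotientD[of S \<mu> "hzeta c \<alpha>" t] by (intro that[of S]) (auto simp: admissible_sets_def)
qed

text \<open>The disjoint family selected from the sets of large quotient is countable since each of them
  has positive measure inside \<open>V\<close>. Finitely many of its members cover \<open>B\<close> up to the enlargements
  of the remaining ones, whose total contribution is a small tail.\<close>

lemma density_lower:
  fixes \<mu> :: "'a::metric_space set \<Rightarrow> ennreal"
  assumes c: "0 < c" and \<alpha>: "0 < \<alpha>" and \<mu>: "measure_over \<mu>" "borel_regular \<mu>" and t: "0 < t"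
    and V: "open V" "\<mu> V < \<infinity>" and BV: "B \<subseteq> V"
    and B: "\<And>x. x \<in> B \<Longrightarrow> ennreal t < federer_density c \<alpha> \<mu> x"
  shows "ennreal t * hausdorff_measure c \<alpha> B \<le> \<mu> V"
proof -
  let ?\<zeta> = "hzeta c \<alpha> :: 'a set \<Rightarrow> ennreal" and ?M = "caratheodory_measure \<mu>"
  have M: "S \<in> sets ?M" "emeasure ?M S = \<mu> S" if "S \<in> sets borel" for S
    using that borel_caratheodory_sets[OF \<mu>(2)]
    by (auto simp: sets_caratheodory_measure[OF \<mu>(1)] emeasure_caratheodory_measure[OF \<mu>(1)])
  have "ennreal t * hausdorff_pre c \<alpha> \<delta> B \<le> \<mu> V" if \<delta>: "0 < \<delta>" for \<delta>
  proof -
    \<comment> \<open>The fraction \<open>\<delta> / 5\<close> leaves room for the fivefold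
      enlargement below, and the strict inequality forces \<open>\<mu> S\<close> to be
      positive.\<close>
    define F where "F = {S. closed S \<and> S \<subseteq> V \<and> S \<noteq> {} \<and> ediam S \<le> ennreal (\<delta> / 5) \<and> ennreal t * ?\<zeta> S < \<mu> S}"
    have fine: "\<exists>S\<in>F. x \<in> S \<and> S \<subseteq> W" if x: "x \<in> B" and W: "open W" "x \<in> W" for x W
    proof -
      have "open (V \<inter> W)" "x \<in> V \<inter> W" using x W V BV by auto
      then obtain r where r: "0 < r" "ball x r \<subseteq> V \<inter> W" by (meson open_contains_ball)
      define e where "e = min r (\<delta> / 5)"
      have "0 < e" using r \<delta> by (simp add: e_def)
      with B[OF x] obtain S where S: "closed S" "x \<in> S" "ediam S < ennreal e" "ennreal t * ?\<zeta> S < \<mu> S"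
        by (rule less_densityD)
      have "S \<subseteq> ball x r"
      proof
        fix y assume "y \<in> S"
        then have "ennreal (dist x y) < ennreal e"
          using dist_le_ediam[OF S(2)] S(3) by (blast intro: le_less_trans)
        then show "y \<in> ball x r" by (simp add: ennreal_less_iff e_def mem_ball)
      qed
      moreover have "ediam S \<le> ennreal (\<delta> / 5)"
        using order_less_le_trans[OF S(3) ennreal_leI[of e "\<delta> / 5"]] by (simp add: e_def less_imp_le)
      ultimately show ?thesis using S r by (intro bexI[of _ S]) (auto simp: F_def)
    qed
    have small: "ediam S < \<infinity>" if "S \<in> F" for S
      using that by (auto simp: F_def intro: le_less_trans)
    obtain G where G: "G \<subseteq> F" "disjoint G"
      and sel: "\<And>S. S \<in> F \<Longrightarrow> \<exists>T\<in>G. S \<inter> T \<noteq> {} \<and> enn2real (ediam S) \<le> 2 * enn2real (ediam T)"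
    proof (rule vitali_selection[of F "\<lambda>S. enn2real (ediam S)" "\<delta> / 5"])
      show "0 \<le> enn2real (ediam S) \<and> enn2real (ediam S) \<le> \<delta> / 5" if "S \<in> F" for S
        using that \<delta> enn2real_leI[of "\<delta> / 5" "ediam S"] by (auto simp: F_def)
    qed (auto simp: F_def)
    have G_borel: "S \<in> sets borel" "S \<subseteq> V" if "S \<in> G" for S
      using that G by (auto simp: F_def)
    have "countable G"
    proof (rule countable_disjoint_positive_emeasure[OF G(2), of ?M V])
      show "emeasure ?M S \<noteq> 0" if "S \<in> G" for S
        using that G M(2)[OF G_borel(1)[OF that]] by (auto simp: F_def)
    qed (use G_borel M V in auto)
    \<comment> \<open>Padding with empty sets makes this enumeration free of repetitions even when
      \<open>G\<close> is finite, so the sequence is disjoint.\<close>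
    define E where "E n = (if n \<in> to_nat_on G ` G then from_nat_into G n else {})" for n
    have E_or: "E n \<in> G \<or> E n = {}" for n
      by (auto simp: E_def \<open>countable G\<close>)
    have E_ex: "\<exists>n. E n = T" if "T \<in> G" for T
      using that \<open>countable G\<close> by (intro exI[of _ "to_nat_on G T"]) (auto simp: E_def)
    have "disjoint_family E"
      unfolding disjoint_family_on_def
    proof (intro ballI impI)
      fix m n :: nat assume "m \<noteq> n"
      show "E m \<inter> E n = {}"
      proof (cases "m \<in> to_nat_on G ` G \<and> n \<in> to_nat_on G ` G")
        case True
        then obtain S T where "S \<in> G" "T \<in> G" "m = to_nat_on G S" "n = to_nat_on G T" by blast
        moreover from this have "S \<noteq> T" using \<open>m \<noteq> n\<close> by blast
        ultimately show ?thesis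
          using G(2) \<open>countable G\<close> by (simp add: E_def disjoint_def)
      qed (auto simp: E_def)
    qed
    have E_borel: "E n \<in> sets borel" "closed (E n)" for n
      using E_or[of n] G by (auto simp: F_def)
    have E_le: "ennreal t * ?\<zeta> (E n) \<le> \<mu> (E n)" and E_sub: "E n \<subseteq> V" for n
      using E_or[of n] G(1) by (auto simp: F_def less_imp_le)
    have "ennreal t * (\<Sum>n. ?\<zeta> (E n)) = (\<Sum>n. ennreal t * ?\<zeta> (E n))" by simp
    also have "\<dots> \<le> (\<Sum>n. \<mu> (E n))"
      by (intro suminf_le summableI E_le)
    also have "\<dots> = (\<Sum>n. emeasure ?M (E n))" using M(2)[OF E_borel(1)] by simp
    also have "\<dots> = emeasure ?M (\<Union>n. E n)"
      using M(1)[OF E_borel(1)] \<open>disjoint_family E\<close> by (intro suminf_emeasure) auto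
    also have "\<dots> \<le> emeasure ?M V"
      using E_sub V by (intro emeasure_mono M) auto
    also have "\<dots> = \<mu> V" using V by (intro M) auto
    finally have sum_le: "ennreal t * (\<Sum>n. ?\<zeta> (E n)) \<le> \<mu> V" .
    then have sum_fin: "(\<Sum>n. ?\<zeta> (E n)) < \<infinity>"
      using V(2) t by (auto simp: less_top[symmetric] ennreal_mult_top top_unique)
    \<comment> \<open>Before taking the closure, each point is within twice the diameter of
      \<open>S\<close> from a point of \<open>S\<close>, which gives the factor 2 + 1 + 2 =
      5.\<close>
    define hat where "hat S = closure (\<Union>{T\<in>F. T \<inter> S \<noteq> {} \<and> enn2real (ediam T) \<le> 2 * enn2real (ediam S)})" for S
    have hat_diam: "ediam (hat S) \<le> ennreal 5 * ediam S" if "S \<in> G \<or> S = {}" for S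
    proof (cases "S = {}")
      case True
      then show ?thesis by (simp add: hat_def)
    next
      case False
      then have "S \<in> F" using that G by auto
      obtain s where s: "ediam S = ennreal s" "0 \<le> s" using small[OF \<open>S \<in> F\<close>] by (cases "ediam S") auto
      have "ediam (hat S) \<le> ennreal (5 * s)"
        unfolding hat_def
      proof (rule ediam_closure_le)
        fix x y
        assume "x \<in> \<Union>{T\<in>F. T \<inter> S \<noteq> {} \<and> enn2real (ediam T) \<le> 2 * enn2real (ediam S)}"
          and "y \<in> \<Union>{T\<in>F. T \<inter> S \<noteq> {} \<and> enn2real (ediam T) \<le> 2 * enn2real (ediam S)}"
        moreover have "\<exists>x'\<in>S. dist x x' \<le> 2 * s"
          if x: "x \<in> \<Union>{T\<in>F. T \<inter> S \<noteq> {} \<and> enn2real (ediam T) \<le> 2 * enn2real (ediam S)}" for x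
        proof -
          obtain T x' where T: "T \<in> F" "x \<in> T" "x' \<in> T" "x' \<in> S" "enn2real (ediam T) \<le> 2 * s"
            using x unfolding s(1) enn2real_ennreal[OF s(2)] by blast
          have "ediam T \<le> ennreal (2 * s)"
            using small[OF T(1)] T(5) by (cases "ediam T") (auto intro: ennreal_leI)
          then show ?thesis using T s by (intro bexI[of _ x'] ediam_le_ennrealD[of T]) auto
        qed
        ultimately obtain x' y' where "x' \<in> S" "dist x x' \<le> 2 * s" "y' \<in> S" "dist y y' \<le> 2 * s" by meson
        moreover have "dist x' y' \<le> s"
          using \<open>x' \<in> S\<close> \<open>y' \<in> S\<close> s by (intro ediam_le_ennrealD[of S]) auto
        moreover have "dist x y \<le> dist x x' + dist x' y' + dist y y'"
          by (metis add.commute add_left_mono dist_commute dist_triangle order_trans add.assoc)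
        ultimately show "dist x y \<le> 5 * s" by linarith
      qed (use s in simp)
      then show ?thesis using s by (simp add: ennreal_mult)
    qed
    define K where "K = ennreal (5 powr \<alpha>)"
    have K: "K < \<infinity>" by (simp add: K_def)
    have hat_zeta: "?\<zeta> (hat (E n)) \<le> K * ?\<zeta> (E n)" for n
      unfolding K_def using E_or[of n] G small hat_diam[OF E_or[of n]]
      by (intro hzeta_le_of_ediam_le[OF c \<alpha>]) auto
    have pre: "hausdorff_pre c \<alpha> \<delta> B \<le> K * (\<Sum>k. ?\<zeta> (E (k + n))) + (\<Sum>k. ?\<zeta> (E k))" for n
    proof -
      \<comment> \<open>Only the tail is enlarged, so the constant \<open>K\<close> multiplies a sum
        that tends to 0 and the limiting bound has constant 1.\<close>
      define W where "W i = (if i < n then E i else hat (E i))" for i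
      have "hausdorff_pre c \<alpha> \<delta> B \<le> (\<Sum>i. ?\<zeta> (W i))"
      proof (rule hausdorff_pre_le)
        show "closed (W i)" for i using E_borel(2) by (simp add: W_def hat_def)
        have E_diam: "ediam (E i) \<le> ennreal (\<delta> / 5)" for i
          using E_or[of i] G by (auto simp: F_def)
        have "ediam (hat (E i)) \<le> ennreal \<delta>" for i
        proof -
          have "ediam (hat (E i)) \<le> ennreal 5 * ediam (E i)" by (rule hat_diam[OF E_or])
          also have "\<dots> \<le> ennreal 5 * ennreal (\<delta> / 5)" by (intro mult_left_mono E_diam) simp
          also have "\<dots> = ennreal \<delta>" using \<delta> by (simp add: ennreal_mult[symmetric] del: ennreal_numeral)
          finally show ?thesis .
        qed
        moreover have "ediam (E i) \<le> ennreal \<delta>" for i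
          using E_diam[of i] \<delta> by (auto elim: order_trans intro: ennreal_leI)
        ultimately show "ediam (W i) \<le> ennreal \<delta>" for i by (simp add: W_def)
        show "B \<subseteq> (\<Union>i. W i)"
        proof
          fix x assume x: "x \<in> B"
          show "x \<in> (\<Union>i. W i)"
          proof (cases "x \<in> (\<Union>i<n. E i)")
            case True
            then show ?thesis by (auto simp: W_def)
          next
            case False
            \<comment> \<open>A member of \<open>F\<close> through \<open>x\<close> can therefore
              avoid the first \<open>n\<close> sets, so its selected partner has index at least
              \<open>n\<close> and its enlargement contains \<open>x\<close>.\<close>
            have "open (- (\<Union>i<n. E i))" using E_borel(2) by auto
            from fine[OF x this] False obtain S where S: "S \<in> F" "x \<in> S" "S \<subseteq> - (\<Union>i<n. E i)" by auto
            from sel[OF S(1)] obtain T where T: "T \<in> G" "S \<inter> T \<noteq> {}" "enn2real (ediam S) \<le> 2 * enn2real (ediam T)"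
              by blast
            from E_ex[OF T(1)] obtain m where m: "E m = T" by blast
            have "\<not> m < n" using S(3) T(2) m by blast
            moreover have "x \<in> hat (E m)"
              unfolding hat_def m by (rule subsetD[OF closure_subset]) (use S T in blast)
            ultimately show ?thesis by (auto simp: W_def)
          qed
        qed
      qed
      also have "\<dots> = (\<Sum>k. ?\<zeta> (W (k + n))) + (\<Sum>i<n. ?\<zeta> (W i))"
        by (rule suminf_offset) auto
      also have "\<dots> \<le> (\<Sum>k. K * ?\<zeta> (E (k + n))) + (\<Sum>k. ?\<zeta> (E k))"
      proof (rule add_mono)
        show "(\<Sum>k. ?\<zeta> (W (k + n))) \<le> (\<Sum>k. K * ?\<zeta> (E (k + n)))"
          by (intro suminf_le summableI) (simp add: W_def hat_zeta)
        have "(\<Sum>i<n. ?\<zeta> (W i)) = (\<Sum>i<n. ?\<zeta> (E i))" by (simp add: W_def)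
        also have "\<dots> \<le> (\<Sum>k. ?\<zeta> (E k))" by (rule sum_le_suminf) auto
        finally show "(\<Sum>i<n. ?\<zeta> (W i)) \<le> (\<Sum>k. ?\<zeta> (E k))" .
      qed
      finally show ?thesis by simp
    qed
    have "hausdorff_pre c \<alpha> \<delta> B \<le> (\<Sum>k. ?\<zeta> (E k))"
    proof (rule ennreal_le_epsilon)
      fix e :: real assume "0 < e"
      define e' where "e' = e / 5 powr \<alpha>"
      have e': "0 < e'" "K * ennreal e' = ennreal e"
        using \<open>0 < e\<close> by (auto simp: e'_def K_def ennreal_mult[symmetric])
      obtain n where n: "(\<Sum>k. ?\<zeta> (E (k + n))) < ennreal e'"
        using ennreal_suminf_small_tail[OF sum_fin, of "ennreal e'"] e' by auto
      have "K * (\<Sum>k. ?\<zeta> (E (k + n))) \<le> ennreal e"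
        using n unfolding e'(2)[symmetric] by (intro mult_left_mono) auto
      then show "hausdorff_pre c \<alpha> \<delta> B \<le> (\<Sum>k. ?\<zeta> (E k)) + ennreal e"
        using order_trans[OF pre[of n] add_right_mono] by (simp add: add.commute)
    qed
    then have "ennreal t * hausdorff_pre c \<alpha> \<delta> B \<le> ennreal t * (\<Sum>k. ?\<zeta> (E k))" by (rule mult_left_mono) simp
    then show ?thesis using sum_le by simp
  qed
  then show ?thesis
    unfolding hausdorff_measure_eq_SUP SUP_mult_left_ennreal by (auto intro: SUP_least)
qed

section \<open>Comparison of measures\<close>

lemma borel_hull:
  assumes "borel_regular \<phi>"
  obtains E' where "E' \<in> sets borel" "E \<subseteq> E'" "\<phi> E' = \<phi> E"
  using assms unfolding borel_regular_def by blast

text \<open>Inside a Borel set of finite \<psi>-measure, \<open>B\<close> is a Borel set up to a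
  \<psi>-null subset of \<open>A\<close>. Absolute continuity makes that remainder \<phi>-null, and
  countably many such pieces make up \<open>B\<close>.\<close>

lemma caratheodory_sets_of_abs_cont:
  fixes \<phi> \<psi> :: "'a::topological_space set \<Rightarrow> ennreal"
  assumes \<phi>: "measure_over \<phi>" "borel_regular \<phi>" and \<psi>: "measure_over \<psi>" "borel_regular \<psi>"
    and fin: "sigma_finite_over \<psi> A" and ac: "abs_cont_restricted A \<phi> \<psi>"
    and B: "B \<subseteq> A" "B \<in> caratheodory_sets \<psi>"
  shows "B \<in> caratheodory_sets \<phi>"
proof -
  interpret \<phi>: sigma_algebra UNIV "caratheodory_sets \<phi>" by (rule sigma_algebra_caratheodory_sets[OF \<phi>(1)])
  obtain \<C> where \<C>: "countable \<C>" "A \<subseteq> \<Union>\<C>" "\<And>C. C \<in> \<C> \<Longrightarrow> \<psi> C < \<infinity>"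
    using fin unfolding sigma_finite_over_def by blast
  have "\<exists>C'. C \<subseteq> C' \<and> B \<inter> C' \<in> caratheodory_sets \<phi>" if C: "C \<in> \<C>" for C
  proof -
    obtain C' where C': "C' \<in> sets borel" "C \<subseteq> C'" "\<psi> C' = \<psi> C" by (rule borel_hull[OF \<psi>(2)])
    obtain D where D: "D \<in> sets borel" "C' - B \<subseteq> D" "\<psi> D = \<psi> (C' - B)" by (rule borel_hull[OF \<psi>(2)])
    \<comment> \<open>\<open>C' - D\<close> lies in \<open>B\<close>, and \<open>N\<close> is the
      rest of \<open>B \<inter> C'\<close>. Splitting \<open>D \<inter> C'\<close> by
      \<open>B\<close> and cancelling the finite \<open>\<psi> (C' - B)\<close> gives
      \<open>\<psi> N = 0\<close>.\<close>
    define N where "N = D \<inter> C' \<inter> B"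
    have "\<psi> (C' - B) \<le> \<psi> C'" by (rule measure_over_mono[OF \<psi>(1)]) auto
    then have f: "\<psi> (C' - B) < \<infinity>" using \<C>(3)[OF C] C'(3) by (auto intro: le_less_trans)
    have "D \<inter> C' - B = C' - B" using D(2) by blast
    moreover have "\<psi> (D \<inter> C') = \<psi> (D \<inter> C' \<inter> B) + \<psi> (D \<inter> C' - B)"
      using B(2) unfolding caratheodory_sets_iff by blast
    ultimately have "\<psi> N + \<psi> (C' - B) = \<psi> (D \<inter> C')" by (simp add: N_def)
    also have "\<dots> \<le> \<psi> D" by (rule measure_over_mono[OF \<psi>(1)]) auto
    also have "\<dots> = 0 + \<psi> (C' - B)" using D by simp
    finally have "\<psi> N = 0" using f by (auto simp: ennreal_add_left_cancel_le add.commute)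
    moreover have "N \<subseteq> A" using B by (auto simp: N_def)
    ultimately have "\<phi> N = 0" using ac by (simp add: abs_cont_restricted_def)
    then have "N \<in> caratheodory_sets \<phi>" by (rule null_caratheodory_sets[OF \<phi>(1)])
    moreover have "C' - D \<in> caratheodory_sets \<phi>"
      using C' D by (intro borel_caratheodory_sets[OF \<phi>(2)]) auto
    moreover have "B \<inter> C' = (C' - D) \<union> N" using D(2) by (auto simp: N_def)
    ultimately have "B \<inter> C' \<in> caratheodory_sets \<phi>" by (metis \<phi>.Un)
    then show ?thesis using C'(2) by blast
  qed
  then obtain h where h: "\<And>C. C \<in> \<C> \<Longrightarrow> C \<subseteq> h C" "\<And>C. C \<in> \<C> \<Longrightarrow> B \<inter> h C \<in> caratheodory_sets \<phi>" by metis
  have "(\<Union>C\<in>\<C>. B \<inter> h C) \<in> caratheodory_sets \<phi>" using \<C>(1) h(2) by (intro \<phi>.countable_UN') auto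
  also have "(\<Union>C\<in>\<C>. B \<inter> h C) = B"
  proof (intro equalityI subsetI)
    fix x assume x: "x \<in> B"
    then obtain C where C: "C \<in> \<C>" "x \<in> C" using \<C>(2) B(1) by auto
    then have "x \<in> h C" using h(1) by auto
    with x C(1) show "x \<in> (\<Union>C\<in>\<C>. B \<inter> h C)" by auto
  qed auto
  finally show ?thesis .
qed

lemma
  assumes "measure_over \<phi>" "A \<in> caratheodory_sets \<phi>"
  shows sets_restrict_caratheodory_measure:
      "sets (restrict_space (caratheodory_measure \<phi>) A) = {B. B \<subseteq> A \<and> B \<in> caratheodory_sets \<phi>}"
    and emeasure_restrict_caratheodory_measure:
      "B \<subseteq> A \<Longrightarrow> B \<in> caratheodory_sets \<phi> \<Longrightarrow> emeasure (restrict_space (caratheodory_measure \<phi>) A) B = \<phi> B"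
  using assms
  by (auto simp: sets_restrict_space_iff sets_caratheodory_measure emeasure_caratheodory_measure
      emeasure_restrict_space)

lemma ennreal_mult_le_imp_zero:
  assumes "ennreal t * h \<le> ennreal s * h" "s < t" "0 \<le> s" "h < \<infinity>"
  shows "h = 0"
proof -
  obtain r where r: "h = ennreal r" "0 \<le> r" using assms(4) by (cases h) auto
  then have "t * r \<le> s * r" using assms by (simp add: ennreal_mult[symmetric])
  then show ?thesis using r assms(2) by (simp add: mult_le_cancel_right)
qed

section \<open>The density theorem\<close>

lemma federer_density_eq_AE:
  fixes \<mu> :: "'a::metric_space set \<Rightarrow> ennreal" and f :: "'a \<Rightarrow> ennreal"
    and c \<alpha> :: real and A :: "'a set"
  defines "H \<equiv> hausdorff_measure c \<alpha> :: 'a set \<Rightarrow> ennreal"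
  defines "M \<equiv> restrict_space (caratheodory_measure H) A"
  assumes c: "0 < c" and \<alpha>: "0 < \<alpha>" and \<mu>: "measure_over \<mu>" "borel_regular \<mu>"
    and A: "A \<in> caratheodory_sets H" and fin: "sigma_finite_over H A"
    and \<U>: "countable \<U>" "A \<subseteq> \<Union>\<U>" "\<And>U. U \<in> \<U> \<Longrightarrow> open U \<and> \<mu> U < \<infinity>"
    and f: "f \<in> borel_measurable M"
    and \<mu>_eq: "\<And>B. B \<in> sets M \<Longrightarrow> \<mu> B = (\<integral>\<^sup>+x\<in>B. f x \<partial>M)"
  shows "H {x\<in>A. federer_density c \<alpha> \<mu> x \<noteq> f x} = 0"
proof -
  let ?d = "federer_density c \<alpha> \<mu>"
  note H = measure_over_hausdorff[of c \<alpha>, where 'a='a, folded H_def]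
    borel_regular_hausdorff[of c \<alpha>, where 'a='a, folded H_def]
  interpret CH: sigma_algebra UNIV "caratheodory_sets H" by (rule sigma_algebra_caratheodory_sets[OF H(1)])
  have space_M: "space M = A" by (simp add: M_def space_restrict_space)
  have sets_M: "sets M = {B. B \<subseteq> A \<and> B \<in> caratheodory_sets H}"
    unfolding M_def by (rule sets_restrict_caratheodory_measure[OF H(1) A])
  have emeasure_M: "emeasure M B = H B" if "B \<in> sets M" for B
    using that sets_M unfolding M_def by (intro emeasure_restrict_caratheodory_measure[OF H(1) A]) auto
  have borel_M: "S \<inter> P \<in> sets M" if "S \<in> sets M" "P \<in> sets borel" for S P
    using that borel_caratheodory_sets[OF H(2)] by (auto simp: sets_M)
  have level: "{x\<in>A. f x < r} \<in> sets M" "{x\<in>A. r < f x} \<in> sets M" for r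
    using f unfolding space_M[symmetric] by measurable
  obtain \<C> where \<C>: "countable \<C>" "A \<subseteq> \<Union>\<C>" "\<And>C. C \<in> \<C> \<Longrightarrow> H C < \<infinity>"
    using fin unfolding sigma_finite_over_def by blast
  \<comment> \<open>The lower density bound needs an open set of finite \<mu>-measure and the final
    cancellation needs finite \<open>H\<close>, so nullity is tested on pieces having both.\<close>
  have localize: "H Z = 0"
    if Z: "Z \<subseteq> A" and null: "\<And>P U. P \<subseteq> Z \<Longrightarrow> P \<subseteq> U \<Longrightarrow> U \<in> \<U> \<Longrightarrow> H P < \<infinity> \<Longrightarrow> H P = 0" for Z
  proof -
    have "H (\<Union>(C, U)\<in>\<C> \<times> \<U>. Z \<inter> C \<inter> U) = 0"
    proof (rule measure_over_null_UN[OF H(1)])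
      show "countable (\<C> \<times> \<U>)" using \<C>(1) \<U>(1) by simp
      fix i assume "i \<in> \<C> \<times> \<U>"
      then obtain C U where i: "i = (C, U)" "C \<in> \<C>" "U \<in> \<U>" by blast
      have "H (Z \<inter> C \<inter> U) \<le> H C" by (rule measure_over_mono[OF H(1)]) auto
      then have "H (Z \<inter> C \<inter> U) < \<infinity>" using \<C>(3)[OF i(2)] by (rule le_less_trans)
      with i show "H (case i of (C, U) \<Rightarrow> Z \<inter> C \<inter> U) = 0"
        by simp (rule null[of _ U], auto)
    qed
    moreover have "Z \<subseteq> (\<Union>(C, U)\<in>\<C> \<times> \<U>. Z \<inter> C \<inter> U)"
    proof
      fix x assume x: "x \<in> Z"
      then have "x \<in> \<Union>\<C>" "x \<in> \<Union>\<U>" using Z \<C>(2) \<U>(2) by auto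
      then obtain C U where "C \<in> \<C>" "x \<in> C" "U \<in> \<U>" "x \<in> U" by (elim UnionE)
      with x show "x \<in> (\<Union>(C, U)\<in>\<C> \<times> \<U>. Z \<inter> C \<inter> U)" by auto
    qed
    ultimately show ?thesis by (rule measure_over_null_mono[OF H(1), rotated])
  qed
  have below: "H {x\<in>A. f x < ennreal s \<and> ennreal t < ?d x} = 0" if st: "0 < s" "s < t" for s t
  proof (rule localize)
    fix P U assume P: "P \<subseteq> {x\<in>A. f x < ennreal s \<and> ennreal t < ?d x}" "P \<subseteq> U" "U \<in> \<U>" "H P < \<infinity>"
    obtain P' where P': "P' \<in> sets borel" "P \<subseteq> P'" "H P' = H P" by (rule borel_hull[OF H(2)])
    \<comment> \<open>The hull of \<open>P\<close> is cut back to where \<open>f\<close> is below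
      \<open>s\<close>: this gives a measurable set containing \<open>P\<close>, on which \<mu> is
      at most \<open>s\<close> times \<open>H\<close>.\<close>
    define Q where "Q = {x\<in>A. f x < ennreal s} \<inter> P'"
    have Q: "Q \<in> sets M" unfolding Q_def by (intro borel_M level P')
    have "ennreal t * H P \<le> \<mu> P"
    proof (rule ennreal_le_epsilon)
      fix e :: real assume "0 < e"
      with \<U>(3)[OF P(3)] P(2) obtain V where V: "open V" "P \<subseteq> V" "V \<subseteq> U" "\<mu> V \<le> \<mu> P + ennreal e"
        using borel_regular_open_approx[OF \<mu>, of U P e] by blast
      have "\<mu> V < \<infinity>" using measure_over_mono[OF \<mu>(1) V(3)] \<U>(3)[OF P(3)] by (blast intro: le_less_trans)
      then have "ennreal t * H P \<le> \<mu> V"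
        unfolding H_def using V P(1) st by (intro density_lower[OF c \<alpha> \<mu>]) auto
      then show "ennreal t * H P \<le> \<mu> P + ennreal e" using V(4) by (rule order_trans)
    qed
    also have "\<mu> P \<le> \<mu> Q" using P P' by (intro measure_over_mono[OF \<mu>(1)]) (auto simp: Q_def)
    also have "\<mu> Q = (\<integral>\<^sup>+x\<in>Q. f x \<partial>M)" by (rule \<mu>_eq[OF Q])
    also have "\<dots> \<le> (\<integral>\<^sup>+x. ennreal s * indicator Q x \<partial>M)"
      by (intro nn_integral_mono) (auto simp: Q_def less_imp_le split: split_indicator)
    also have "\<dots> = ennreal s * H Q" using Q by (simp add: nn_integral_cmult_indicator emeasure_M)
    also have "\<dots> \<le> ennreal s * H P'"
      by (intro mult_left_mono measure_over_mono[OF H(1)]) (auto simp: Q_def)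
    finally show "H P = 0" using st P(4) unfolding P'(3) by (intro ennreal_mult_le_imp_zero[of t _ s]) auto
  qed auto
  have above: "H {x\<in>A. ennreal t < f x \<and> ?d x < ennreal s} = 0" if st: "0 < s" "s < t" for s t
  proof (rule localize)
    fix P U assume P: "P \<subseteq> {x\<in>A. ennreal t < f x \<and> ?d x < ennreal s}" "H P < \<infinity>"
    \<comment> \<open>Here the hull is taken for \<mu>, since the integral of \<open>f\<close> must
      be compared with \<open>\<mu> P\<close>, which \<open>density_upper\<close> controls.\<close>
    obtain P' where P': "P' \<in> sets borel" "P \<subseteq> P'" "\<mu> P' = \<mu> P" by (rule borel_hull[OF \<mu>(2)])
    define Q where "Q = {x\<in>A. ennreal t < f x} \<inter> P'"
    have Q: "Q \<in> sets M" unfolding Q_def by (intro borel_M level P')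
    have "ennreal t * H P \<le> ennreal t * H Q"
      using P P' by (intro mult_left_mono measure_over_mono[OF H(1)]) (auto simp: Q_def)
    also have "\<dots> = (\<integral>\<^sup>+x. ennreal t * indicator Q x \<partial>M)"
      using Q by (simp add: nn_integral_cmult_indicator emeasure_M)
    also have "\<dots> \<le> (\<integral>\<^sup>+x\<in>Q. f x \<partial>M)"
      by (intro nn_integral_mono) (auto simp: Q_def less_imp_le split: split_indicator)
    also have "\<dots> = \<mu> Q" by (rule \<mu>_eq[OF Q, symmetric])
    also have "\<dots> \<le> \<mu> P'" by (intro measure_over_mono[OF \<mu>(1)]) (auto simp: Q_def)
    also have "\<dots> \<le> ennreal s * H P"
      unfolding P'(3) H_def using P st by (intro density_upper[OF \<mu>]) auto
    finally show "H P = 0" using st P(2) by (intro ennreal_mult_le_imp_zero[of t _ s]) auto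
  qed auto
  \<comment> \<open>Wherever \<open>f\<close> and the density differ, two positive rationals fit
    strictly between them, so countably many null sets suffice.\<close>
  let ?I = "{(s, t). 0 < s \<and> s < (t::rat)}"
  let ?Z = "\<lambda>(s, t). {x\<in>A. f x < ennreal (of_rat s) \<and> ennreal (of_rat t) < ?d x} \<union>
    {x\<in>A. ennreal (of_rat t) < f x \<and> ?d x < ennreal (of_rat s)}"
  have rat: "\<exists>s t. 0 < s \<and> s < t \<and> a < ennreal (of_rat s) \<and> ennreal (of_rat t) < b" if ab: "a < b" for a b
  proof -
    obtain s where s: "a < ennreal (of_rat s)" "ennreal (of_rat s) < b" using ennreal_rat_dense[OF ab] by blast
    obtain t where t: "ennreal (of_rat s) < ennreal (of_rat t)" "ennreal (of_rat t) < b"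
      using ennreal_rat_dense[OF s(2)] by blast
    \<comment> \<open>A nonpositive \<open>s\<close> would be sent to 0 by \<open>ennreal\<close>,
      and nothing lies below 0.\<close>
    have "0 < s" using s(1) by (metis ennreal_neg not_le not_less_zero of_rat_le_0_iff)
    moreover have "s < t" using t(1) by (metis ennreal_less_iff ennreal_leI not_le of_rat_less_eq)
    ultimately show ?thesis using s t by blast
  qed
  have "H (\<Union>i\<in>?I. ?Z i) = 0"
  proof (rule measure_over_null_UN[OF H(1)])
    fix i assume "i \<in> ?I"
    then obtain s t where i: "i = (s, t)" "0 < real_of_rat s" "real_of_rat s < real_of_rat t"
      by (auto simp: of_rat_less)
    have "H (?Z i) \<le> 0 + 0"
      unfolding i(1) prod.case
      by (rule order_trans[OF measure_over_Un[OF H(1)]]) (simp only: below[OF i(2,3)] above[OF i(2,3)] order_refl)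
    then show "H (?Z i) = 0" by simp
  qed (rule countableI_type)
  moreover have "{x\<in>A. ?d x \<noteq> f x} \<subseteq> (\<Union>i\<in>?I. ?Z i)"
  proof
    fix x assume x: "x \<in> {x\<in>A. ?d x \<noteq> f x}"
    then consider "f x < ?d x" | "?d x < f x" by fastforce
    then show "x \<in> (\<Union>i\<in>?I. ?Z i)"
      by cases (use rat x in fastforce)+
  qed
  ultimately show ?thesis by (rule measure_over_null_mono[OF H(1), rotated])
qed

section \<open>Radon-Nikodym density and the integral formula\<close>

theorem theorem5p3:
  fixes \<mu> :: "'a::metric_space set \<Rightarrow> ennreal" and c \<alpha> :: real and A :: "'a set"
  assumes "c > 0" and "\<alpha> > 0"
    and "measure_over \<mu>"
    and "borel_regular \<mu>"
    and "covers_finely (admissible_sets \<mu> (hzeta c \<alpha>)) A"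
    and "A \<in> caratheodory_sets (hausdorff_measure c \<alpha>)"
    and "sigma_finite_over (hausdorff_measure c \<alpha>) A"
    and "\<exists>\<U>. countable \<U> \<and> A \<subseteq> \<Union>\<U> \<and> (\<forall>U\<in>\<U>. open U \<and> \<mu> U < \<infinity>)"
    and "abs_cont_restricted A \<mu> (hausdorff_measure c \<alpha>)"
  shows "federer_density c \<alpha> \<mu>
           \<in> borel_measurable (restrict_space (caratheodory_measure (hausdorff_measure c \<alpha>)) A)
    \<and> (\<forall>B. B \<subseteq> A \<longrightarrow> B \<in> caratheodory_sets (hausdorff_measure c \<alpha>) \<longrightarrow>
          B \<in> caratheodory_sets \<mu> \<and>
          \<mu> B = (\<integral>\<^sup>+x\<in>B. federer_density c \<alpha> \<mu> x \<partial>caratheodory_measure (hausdorff_measure c \<alpha>)))"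
proof -
  define H where "H = (hausdorff_measure c \<alpha> :: 'a set \<Rightarrow> ennreal)"
  let ?d = "federer_density c \<alpha> \<mu>"
  note \<mu> = assms(3,4)
  note H = measure_over_hausdorff[of c \<alpha>, where 'a='a, folded H_def]
    borel_regular_hausdorff[of c \<alpha>, where 'a='a, folded H_def]
  note A = assms(6)[folded H_def] and fin = assms(7)[folded H_def] and ac = assms(9)[folded H_def]
  interpret CH: sigma_algebra UNIV "caratheodory_sets H" by (rule sigma_algebra_caratheodory_sets[OF H(1)])
  define M where "M = restrict_space (caratheodory_measure H) A"
  define L where "L = restrict_space (caratheodory_measure \<mu>) A"
  have \<mu>_sets: "B \<in> caratheodory_sets \<mu>" if "B \<subseteq> A" "B \<in> caratheodory_sets H" for B
    using that by (rule caratheodory_sets_of_abs_cont[OF \<mu> H fin ac])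
  have A\<mu>: "A \<in> caratheodory_sets \<mu>" using A by (intro \<mu>_sets) auto
  have space_M: "space M = A" by (simp add: M_def space_restrict_space)
  have sets_M: "sets M = {B. B \<subseteq> A \<and> B \<in> caratheodory_sets H}"
    unfolding M_def by (rule sets_restrict_caratheodory_measure[OF H(1) A])
  have emeasure_M: "emeasure M B = H B" if "B \<in> sets M" for B
    using that sets_M unfolding M_def by (intro emeasure_restrict_caratheodory_measure[OF H(1) A]) auto
  have sets_L: "sets L = {B. B \<subseteq> A \<and> B \<in> caratheodory_sets \<mu>}"
    unfolding L_def by (rule sets_restrict_caratheodory_measure[OF \<mu>(1) A\<mu>])
  have space_L: "space L = A" by (simp add: L_def space_restrict_space)
  have vimage: "id -` B \<inter> space L = B" if "B \<in> sets M" for B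
    using that by (auto simp: space_L sets_M)
  have id: "id \<in> L \<rightarrow>\<^sub>M M"
    using \<mu>_sets by (intro measurableI) (simp add: space_M space_L, subst vimage, auto simp: sets_M sets_L)
  \<comment> \<open>Radon-Nikodym compares measures on one sigma-algebra, so \<mu> is moved to the
    \<open>H\<close>-measurable subsets of \<open>A\<close>, all of which are \<mu>-measurable by
    \<open>\<mu>_sets\<close>.\<close>
  define N where "N = distr L M id"
  have emeasure_N: "emeasure N B = \<mu> B" if B: "B \<in> sets M" for B
  proof -
    have "emeasure N B = emeasure L B"
      unfolding N_def emeasure_distr[OF id B] vimage[OF B] ..
    also have "\<dots> = \<mu> B"
      using B \<mu>_sets[of B] sets_M unfolding L_def
      by (intro emeasure_restrict_caratheodory_measure[OF \<mu>(1) A\<mu>]) auto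
    finally show ?thesis .
  qed
  have sigma_finite: "sigma_finite_measure M"
  proof
    obtain \<C> where \<C>: "countable \<C>" "A \<subseteq> \<Union>\<C>" "\<And>C. C \<in> \<C> \<Longrightarrow> H C < \<infinity>"
      using fin unfolding sigma_finite_over_def by blast
    obtain h where h: "\<And>C. h C \<in> sets borel" "\<And>C. C \<subseteq> h C" "\<And>C. H (h C) = H C"
      using H(2) unfolding borel_regular_def by metis
    have sets: "A \<inter> h C \<in> sets M" for C
      using A borel_caratheodory_sets[OF H(2) h(1)] by (auto simp: sets_M)
    show "\<exists>\<A>. countable \<A> \<and> \<A> \<subseteq> sets M \<and> \<Union>\<A> = space M \<and> (\<forall>a\<in>\<A>. emeasure M a \<noteq> \<infinity>)"
    \<comment> \<open>The given sets of finite measure may be non-measurable; their Borel hulls have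
      the same measure and become members of \<open>sets M\<close> when cut with
      \<open>A\<close>.\<close>
    proof (intro exI[of _ "(\<lambda>C. A \<inter> h C) ` \<C>"] conjI)
      have "A \<subseteq> (\<Union>C\<in>\<C>. h C)"
        using \<C>(2) by (rule order_trans) (rule Union_least, rule SUP_upper2, assumption, rule h(2))
      then show "\<Union> ((\<lambda>C. A \<inter> h C) ` \<C>) = space M" unfolding space_M by auto
      have "H (A \<inter> h C) < \<infinity>" if "C \<in> \<C>" for C
      proof -
        have "H (A \<inter> h C) \<le> H (h C)" by (rule measure_over_mono[OF H(1)]) auto
        also have "\<dots> < \<infinity>" using \<C>(3)[OF that] h(3) by simp
        finally show ?thesis .
      qed
      then show "\<forall>a\<in>(\<lambda>C. A \<inter> h C) ` \<C>. emeasure M a \<noteq> \<infinity>" using sets by (simp add: emeasure_M less_top)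
    qed (use \<C>(1) sets in auto)
  qed
  have "absolutely_continuous M N"
    unfolding absolutely_continuous_def
  proof
    fix B assume "B \<in> null_sets M"
    then have B: "B \<in> sets M" "H B = 0" by (auto simp: null_sets_def emeasure_M)
    then have "\<mu> B = 0" using ac by (auto simp: abs_cont_restricted_def sets_M)
    with B(1) show "B \<in> null_sets N" by (auto simp: null_sets_def emeasure_N) (simp add: N_def)
  qed
  then obtain f where f: "f \<in> borel_measurable M" "density M f = N"
    using sigma_finite_measure.Radon_Nikodym[OF sigma_finite, of N] by (auto simp: N_def)
  have \<mu>_eq: "\<mu> B = (\<integral>\<^sup>+x\<in>B. f x \<partial>M)" if "B \<in> sets M" for B
    using emeasure_N[OF that] emeasure_density[OF f(1) that] f(2) by simp
  define Z where "Z = {x\<in>A. ?d x \<noteq> f x}"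
  obtain \<U> where \<U>: "countable \<U>" "A \<subseteq> \<Union>\<U>" "\<And>U. U \<in> \<U> \<Longrightarrow> open U \<and> \<mu> U < \<infinity>"
    using assms(8) by blast
  have HZ: "H Z = 0"
    unfolding Z_def H_def
    by (rule federer_density_eq_AE[OF assms(1,2) \<mu> A[unfolded H_def] fin[unfolded H_def] \<U>])
       (use f(1) \<mu>_eq in \<open>auto simp: M_def H_def\<close>)
  \<comment> \<open>Caratheodory's sets are complete: whatever the density does on \<open>Z\<close>,
    its preimages there are measurable, so it inherits measurability from \<open>f\<close>.\<close>
  have sub_Z: "Y \<in> sets M" if "Y \<subseteq> Z" for Y
  proof -
    have "H Y = 0" using measure_over_mono[OF H(1) that] HZ by simp
    then show ?thesis using null_caratheodory_sets[OF H(1)] that by (auto simp: sets_M Z_def)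
  qed
  have d_meas: "?d \<in> borel_measurable M"
  proof (rule measurableI)
    fix W :: "ennreal set" assume "W \<in> sets borel"
    then have "f -` W \<inter> space M \<in> sets M" using f(1) by (rule measurable_sets[rotated])
    then have "(f -` W \<inter> space M - Z) \<union> (?d -` W \<inter> Z) \<in> sets M"
      using sub_Z[of Z] sub_Z[of "?d -` W \<inter> Z"] by auto
    also have "(f -` W \<inter> space M - Z) \<union> (?d -` W \<inter> Z) = ?d -` W \<inter> space M"
      by (auto simp: space_M Z_def)
    finally show "?d -` W \<inter> space M \<in> sets M" .
  qed simp
  have "\<mu> B = (\<integral>\<^sup>+x\<in>B. ?d x \<partial>caratheodory_measure H)" if B: "B \<subseteq> A" "B \<in> caratheodory_sets H" for B
  proof -
    have BM: "B \<in> sets M" using B by (simp add: sets_M)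
    have "AE x in M. f x = ?d x"
      using sub_Z[of Z] HZ by (intro AE_I[of _ _ Z]) (auto simp: Z_def space_M emeasure_M)
    then have "\<mu> B = (\<integral>\<^sup>+x\<in>B. ?d x \<partial>M)"
      unfolding \<mu>_eq[OF BM] by (intro nn_integral_cong_AE) auto
    \<comment> \<open>Passing from \<open>M\<close> to the whole space introduces the indicator of
      \<open>A\<close>, which that of \<open>B\<close> absorbs.\<close>
    also have "\<dots> = (\<integral>\<^sup>+x. ?d x * indicator B x * indicator A x \<partial>caratheodory_measure H)"
      unfolding M_def using A by (intro nn_integral_restrict_space) (simp add: sets_caratheodory_measure[OF H(1)])
    also have "\<dots> = (\<integral>\<^sup>+x\<in>B. ?d x \<partial>caratheodory_measure H)"
      using B(1) by (intro nn_integral_cong) (auto split: split_indicator)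
    finally show ?thesis .
  qed
  then show ?thesis
    using d_meas \<mu>_sets unfolding M_def H_def by blast
qed

end
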